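(* For every integer $t\ge 6$, the graph $F_t$ is connected and strongly nice, but it is not Schur positive. More precisely, $$[s_{(3,3,3,1^{t-3})}]X_{F_t}=-4(t-1)\,(t-1)!<0.$$
   Context: For a finite simple graph $G=(V,E)$, the chromatic symmetric function is $X_G=\sum_{\kappa}\prod_{v\in V}x_{\kappa(v)}$, where the sum ranges over all proper colorings $\kappa:V\to\mathbb N=\{1,2,\ldots\}$. It is a homogeneous symmetric function of degree $|V|$ in $x_1,x_2,\ldots$. Let $m_\lambda$ and $s_\lambda$ denote the monomial and Schur symmetric functions, and let $[b_\lambda]f$ be the coefficient of $b_\lambda$ in the expansion of $f$ in the basis $\{b_\lambda\}$. Write $X_G=\sum_{\lambda\vdash |V|}a_\lambda(G)m_\lambda$. For partitions $\lambda,\mu\vdash n$, $\lambda\ge\mu$ (dominance order) means $\sum_{i=1}^k\lambda_i\ge\sum_{i=1}^k\mu_i$ for every $k\ge1$ (parts beyond the length are $0$). Exponents in partitions denote repeated parts. $G$ is Schur positive if all coefficients of $X_G$ in the Schur basis are nonnegative. $G$ is strongly nice if $a_\lambda(G)\le a_\mu(G)$ for all $\lambda,\mu\vdash|V(G)|$ with $\lambda\ge\mu$. The graph $F_t$: let $H=K_{3,3}-e$ be the complete bipartite graph $K_{3,3}$ with one edge $e$ deleted, and let $a$ be an endpoint of the deleted edge $e$. Take a complete graph $K_t$ on vertices $\{w,c_2,\ldots,c_t\}$, disjoint from $H$, and add to $H\sqcup K_t$ only the single edge $aw$. The resulting graph is $F_t$. *)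

theory Defs
  imports
    "Graph_Theory.Graph_Theory"
    "HOL-Library.Poly_Mapping"
    "HOL-Library.Function_Algebras"
    "HOL-Library.FuncSet"
    "HOL-Library.Multiset"
begin

section \<open>Formal series in $x_1, x_2, \ldots$\<close>

text \<open>
  A monomial is its exponent vector, of type \<^typ>\<open>nat \<Rightarrow>\<^sub>0 nat\<close>; the product of
  monomials is the sum of exponent vectors. A formal series over the integers is the function
  sending each monomial to its coefficient. The variables are numbered from 1, so
  all series below have coefficient 0 at every monomial that involves index 0.

  Integer scalars suffice because the monomial and the Schur functions are bases of the
  symmetric functions over the integers; the coefficients do not change over the rationals.
\<close>

type_synonym monomial = "nat \<Rightarrow>\<^sub>0 nat"
type_synonym series = "monomial \<Rightarrow> int"

definition var :: "nat \<Rightarrow> monomial" where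
  "var i = Poly_Mapping.single i 1"

definition series_scale :: "int \<Rightarrow> series \<Rightarrow> series" where
  "series_scale c f = (\<lambda>\<alpha>. c * f \<alpha>)"

global_interpretation series: module series_scale
  by unfold_locales (auto simp: series_scale_def fun_eq_iff algebra_simps)

section \<open>Partitions\<close>

definition is_partition :: "nat list \<Rightarrow> bool" where
  "is_partition \<mu> \<longleftrightarrow> sorted_wrt (\<ge>) \<mu> \<and> 0 \<notin> set \<mu>"

definition partitions_of :: "nat \<Rightarrow> nat list set" where
  "partitions_of n = {\<mu>. is_partition \<mu> \<and> sum_list \<mu> = n}"

definition dominates :: "nat list \<Rightarrow> nat list \<Rightarrow> bool" where
  "dominates \<nu> \<mu> \<longleftrightarrow> (\<forall>k\<ge>1. sum_list (take k \<nu>) \<ge> sum_list (take k \<mu>))"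

section \<open>Monomial and Schur symmetric functions\<close>

text \<open>The sum of all distinct monomials whose nonzero exponents are a rearrangement of \<open>\<mu>\<close>.\<close>

definition monomial_sym :: "nat list \<Rightarrow> series" where
  "monomial_sym \<mu> = (\<lambda>\<alpha>. of_bool (Poly_Mapping.keys \<alpha> \<subseteq> {1..} \<and>
     image_mset (Poly_Mapping.lookup \<alpha>) (mset_set (Poly_Mapping.keys \<alpha>)) = mset \<mu>))"

definition young_diagram :: "nat list \<Rightarrow> (nat \<times> nat) set" where
  "young_diagram \<mu> = {(i, j). i < length \<mu> \<and> j < \<mu> ! i}"

text \<open>Semistandard tableaux: rows (fixed \<open>i\<close>) increase weakly, columns strictly.\<close>

definition ssyt :: "nat list \<Rightarrow> (nat \<times> nat \<Rightarrow> nat) set" where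
  "ssyt \<mu> = {T \<in> young_diagram \<mu> \<rightarrow>\<^sub>E {1..}.
     (\<forall>i j j'. (i, j) \<in> young_diagram \<mu> \<and> (i, j') \<in> young_diagram \<mu> \<and> j < j'
        \<longrightarrow> T (i, j) \<le> T (i, j')) \<and>
     (\<forall>i i' j. (i, j) \<in> young_diagram \<mu> \<and> (i', j) \<in> young_diagram \<mu> \<and> i < i'
        \<longrightarrow> T (i, j) < T (i', j))}"

text \<open>The sum over all semistandard tableaux \<open>T\<close> of the monomials $\prod_c x_{T(c)}$,
  written through its coefficients.\<close>

definition schur :: "nat list \<Rightarrow> series" where
  "schur \<mu> = (\<lambda>\<alpha>. int (card {T \<in> ssyt \<mu>. (\<Sum>c\<in>young_diagram \<mu>. var (T c)) = \<alpha>}))"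

text \<open>
  The coefficient of \<open>b \<mu>\<close> in the expansion of \<open>f\<close> in the basis formed by all \<open>b \<nu>\<close>.
  Here \<^const>\<open>series.representation\<close> is the coordinate function of a vector with respect
  to a linearly independent set, and is 0 by convention for vectors outside its span.
\<close>

definition basis_coeff :: "(nat list \<Rightarrow> series) \<Rightarrow> nat list \<Rightarrow> series \<Rightarrow> int" where
  "basis_coeff b \<mu> f = series.representation (b ` Collect is_partition) f (b \<mu>)"

section \<open>Chromatic symmetric functions\<close>

text \<open>
  Finite simple graphs are the \<^locale>\<open>pair_graph\<close>s of the Graph Theory library: every edge is present as
  two opposite arcs. Colorings are extensional, so that they are determined by
  their values on the vertices.
\<close>

definition proper_colorings :: "'a pair_pre_digraph \<Rightarrow> ('a \<Rightarrow> nat) set" where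
  "proper_colorings G = {\<kappa> \<in> pverts G \<rightarrow>\<^sub>E {1..}. \<forall>(u, v) \<in> parcs G. \<kappa> u \<noteq> \<kappa> v}"

definition chromatic_sym :: "'a pair_pre_digraph \<Rightarrow> series" where
  "chromatic_sym G =
     (\<lambda>\<alpha>. int (card {\<kappa> \<in> proper_colorings G. (\<Sum>v\<in>pverts G. var (\<kappa> v)) = \<alpha>}))"

definition schur_positive :: "'a pair_pre_digraph \<Rightarrow> bool" where
  "schur_positive G \<longleftrightarrow> (\<forall>\<mu>. is_partition \<mu> \<longrightarrow> basis_coeff schur \<mu> (chromatic_sym G) \<ge> 0)"

definition strongly_nice :: "'a pair_pre_digraph \<Rightarrow> bool" where
  "strongly_nice G \<longleftrightarrow>
     (\<forall>\<nu> \<in> partitions_of (card (pverts G)). \<forall>\<mu> \<in> partitions_of (card (pverts G)).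
        dominates \<nu> \<mu> \<longrightarrow>
        basis_coeff monomial_sym \<nu> (chromatic_sym G) \<le> basis_coeff monomial_sym \<mu> (chromatic_sym G))"

section \<open>The graphs $F_t$\<close>

datatype vertex = Left nat | Right nat | Clique nat

definition K33 :: "vertex pair_pre_digraph" where
  "K33 = (let A = Left ` {1..3}; B = Right ` {1..3} in
     \<lparr>pverts = A \<union> B, parcs = A \<times> B \<union> B \<times> A\<rparr>)"

definition K33_minus_edge :: "vertex pair_pre_digraph" where
  "K33_minus_edge =
     \<lparr>pverts = pverts K33, parcs = parcs K33 - {(Left 1, Right 1), (Right 1, Left 1)}\<rparr>"

definition clique :: "nat \<Rightarrow> vertex pair_pre_digraph" where
  "clique t = (let C = Clique ` {1..t} in \<lparr>pverts = C, parcs = C \<times> C - Id\<rparr>)"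

text \<open>Here $a$ is \<^term>\<open>Left 1\<close>, $w$ is \<^term>\<open>Clique 1\<close> and
  $c_i$ is \<open>Clique i\<close>.\<close>

definition F_graph :: "nat \<Rightarrow> vertex pair_pre_digraph" where
  "F_graph t =
     \<lparr>pverts = pverts K33_minus_edge \<union> pverts (clique t),
      parcs = parcs K33_minus_edge \<union> parcs (clique t) \<union>
        {(Left 1, Clique 1), (Clique 1, Left 1)}\<rparr>"

lemma complete_bipartite_K33: "complete_bipartite_digraph 3 3 (with_proj K33)"
  unfolding complete_bipartite_digraph_pair_def K33_def Let_def
  by (intro conjI exI[of _ "Left ` {1..3}"] exI[of _ "Right ` {1..3}"])
    (auto simp: card_image inj_on_def)

lemma complete_clique: "complete_digraph t (with_proj (clique t))"
proof -
  have "card (Clique ` {1..t}) = t"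
    by (simp add: card_image inj_on_def)
  then show ?thesis
    unfolding complete_digraph_pair_def clique_def Let_def by auto
qed

lemma pair_graph_F_graph:
  assumes "t \<ge> 1"
  shows "pair_graph (F_graph t)"
proof -
  have arcs: "fst e \<in> pverts (F_graph t) \<and> snd e \<in> pverts (F_graph t) \<and> fst e \<noteq> snd e \<and>
      (snd e, fst e) \<in> parcs (F_graph t)" if "e \<in> parcs (F_graph t)" for e
    using that assms unfolding F_graph_def K33_minus_edge_def K33_def clique_def Let_def
    by (cases e) auto
  have fin: "finite (pverts (F_graph t))"
    by (simp add: F_graph_def K33_minus_edge_def K33_def clique_def Let_def)
  show ?thesis
  proof
    show "finite (parcs (F_graph t))"
      by (rule finite_subset[of _ "pverts (F_graph t) \<times> pverts (F_graph t)"])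
        (use arcs fin in \<open>auto simp: mem_Times_iff\<close>)
    show "symmetric (with_proj (F_graph t))"
      unfolding symmetric_def by (rule symI) (use arcs in fastforce)
  qed (use arcs fin in blast)+
qed

end

theory Submission
  imports Defs
begin

text \<open>
  Write H for K_{3,3} minus an edge. The coefficient of $m_\lambda$ in $X_G$ is the
  coefficient of $x_1^{\lambda_1} x_2^{\lambda_2} \cdots$, that is, the number of ways to cut the
  vertex set into a list of stable sets of sizes $\lambda_1, \lambda_2, \ldots$ (lemma
  \<open>chromatic_sym_expo\<close>). Everything rests on computing these numbers for $F_t$.

  The clique needs t different colors, so the number is 0 if $\lambda$ has fewer than t parts.
  Otherwise the numbers $\lambda_i - 1$ form a partition $\rho$ of some number at most 6, followed by
  zeros: the shapes to consider are indexed by 30 partitions $\rho$, whatever t is. Stable sets of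
  sizes $\rho_i + 1$ have to be chosen, and each remaining vertex is a color class by itself, in any
  order. A stable set meets the clique in at most one vertex, so a choice amounts to disjoint stable
  sets of H, together with the decision which of them receive a clique vertex and which one. For
  t = s + 6 the coefficient is therefore s! times a polynomial in s that depends on $\rho$ only,
  and enumerating the stable sets of H yields all 30 polynomials.

  Strong niceness. Dominance between two such $\lambda$ is weak dominance between the corresponding
  $\rho$, again independently of t. For every comparable pair the inequality between the two
  polynomials already holds coefficient by coefficient, hence for all $s \ge 0$. This finite check
  is lemma \<open>coeff_table_monotone\<close>.

  The Schur coefficient. Schur functions expand unitriangularly into monomial functions with respect
  to dominance. Hence they are linearly independent, they span all homogeneous symmetric series, and
  the coefficient of $s_\lambda$ in $X$ is found by solving a triangular system that involves only
  partitions above $\lambda$. Let $\lambda = (3,3,3,1^{t-3})$ and $z = (t-1)\,(t-1)!$. Strictly above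
  $\lambda$ the Schur coefficients vanish except at $(4,4,1^{t-2})$ and $(4,3,2,1^{t-3})$. The monomial
  coefficients at these two partitions and at $\lambda$ are 2 z, 6 z and 6 z, and the Kostka numbers
  between the three partitions are 1, 1 and 2. So the Schur coefficients are 2 z, then 6 z - 2 z = 4 z,
  and at $\lambda$ finally 6 z - 2 z - 2 (4 z) = -4 z. Behind this is the identity
  $X_{F_t} = (t-1)\,(t-1)!\; x_1 \cdots x_t\, X_H$ in t variables: multiplication by
  $x_1 \cdots x_t$ adds a full column to every Schur function, and
  $X_H = 2 m_{33} + 6 m_{321} + 6 m_{222} + \cdots$, where the remaining partitions do not dominate
  (2,2,2), gives $X_H = 2 s_{33} + 4 s_{321} - 4 s_{222} + \cdots$.

  That Schur functions are symmetric, which the spanning argument needs, is shown on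
  Gelfand--Tsetlin patterns: there the Bender--Knuth involution reflects each entry of one level
  inside the interval that its neighbors allow.
\<close>

section \<open>Dominance order\<close>

lemma dominates_refl: "dominates xs xs"
  by (simp add: dominates_def)

lemma dominates_trans: "dominates xs ys \<Longrightarrow> dominates ys zs \<Longrightarrow> dominates xs zs"
  unfolding dominates_def by (meson le_trans)

lemma eq_if_same_partial_sums:
  assumes "\<And>k. sum_list (take k xs) = sum_list (take k ys)" "0 \<notin> set xs" "0 \<notin> set ys"
  shows "xs = (ys :: nat list)"
  using assms
proof (induction xs arbitrary: ys)
  case Nil
  then show ?case
    using Nil.prems(1)[of 1] by (cases ys) auto
next
  case (Cons x xs)
  show ?case
  proof (cases ys)
    case Nil
    then show ?thesis using Cons.prems(1)[of 1] Cons.prems(2) by auto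
  next
    case (Cons y zs)
    have xy: "x = y"
      using Cons.prems(1)[of 1] Cons by simp
    have sums: "sum_list (take k xs) = sum_list (take k zs)" for k
      using Cons.prems(1)[of "Suc k"] Cons xy by simp
    have "xs = zs"
      by (rule Cons.IH[OF sums]) (use Cons.prems(2,3) Cons in simp_all)
    then show ?thesis
      using Cons xy by simp
  qed
qed

lemma dominates_antisym:
  assumes "is_partition xs" "is_partition ys" "dominates xs ys" "dominates ys xs"
  shows "xs = ys"
proof (rule eq_if_same_partial_sums)
  show "sum_list (take k xs) = sum_list (take k ys)" for k
  proof (cases "k = 0")
    case False
    then have "1 \<le> k" by simp
    then show ?thesis
      using assms(3,4) unfolding dominates_def by (intro antisym) blast+
  qed simp
qed (use assms(1,2) in \<open>simp_all add: is_partition_def\<close>)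

lemma dominates_length_le:
  assumes "is_partition xs" "dominates xs ys" "sum_list xs = sum_list ys"
  shows "length xs \<le> length ys"
proof (rule ccontr)
  assume *: "\<not> length xs \<le> length ys"
  let ?k = "length ys"
  have "sum_list (take ?k xs) \<ge> sum_list (take ?k ys)"
    using assms(2)[unfolded dominates_def, rule_format, of ?k] by (cases "ys = []") (auto simp: Suc_le_eq)
  moreover have "sum_list xs = sum_list (take ?k xs) + sum_list (drop ?k xs)"
    by (metis append_take_drop_id sum_list_append)
  ultimately have "sum_list (drop ?k xs) = 0"
    using assms(3) by simp
  moreover have "drop ?k xs ! 0 \<in> set xs"
    using * by (simp add: nth_mem)
  moreover have "drop ?k xs \<noteq> []" using * by simp
  ultimately show False
    using assms(1) unfolding is_partition_def
    by (metis length_greater_0_conv nth_mem sum_list_eq_0_iff)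
qed

lemma finite_partitions_of: "finite (partitions_of n)"
proof (rule finite_subset)
  show "partitions_of n \<subseteq> {xs. set xs \<subseteq> {..n} \<and> length xs \<le> n}"
  proof
    fix xs assume "xs \<in> partitions_of n"
    then have xs: "0 \<notin> set xs" "sum_list xs = n"
      by (auto simp: partitions_of_def is_partition_def)
    have "sum_list xs \<ge> length xs"
      using xs(1) by (induction xs) auto
    then show "xs \<in> {xs. set xs \<subseteq> {..n} \<and> length xs \<le> n}"
      using xs member_le_sum_list by fastforce
  qed
qed (simp add: finite_lists_length_le)

lemma mem_partitions_of: "is_partition \<mu> \<Longrightarrow> \<mu> \<in> partitions_of (sum_list \<mu>)"
  by (simp add: partitions_of_def)

definition strict_dominance :: "nat \<Rightarrow> (nat list \<times> nat list) set" where
  "strict_dominance n =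
     {(\<nu>, \<mu>) \<in> partitions_of n \<times> partitions_of n. dominates \<nu> \<mu> \<and> \<nu> \<noteq> \<mu>}"

lemma finite_strict_dominance: "finite (strict_dominance n)"
  by (rule finite_subset[of _ "partitions_of n \<times> partitions_of n"])
    (auto simp: strict_dominance_def finite_partitions_of)

lemma acyclic_strict_dominance: "acyclic (strict_dominance n)"
proof -
  have "trans (strict_dominance n)"
  proof (rule transI)
    fix \<kappa> \<mu> \<nu>
    assume *: "(\<kappa>, \<mu>) \<in> strict_dominance n" "(\<mu>, \<nu>) \<in> strict_dominance n"
    then have p: "is_partition \<kappa>" "is_partition \<mu>" "dominates \<kappa> \<mu>" "dominates \<mu> \<nu>" "\<kappa> \<noteq> \<mu>"
      by (auto simp: strict_dominance_def partitions_of_def)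
    then have "dominates \<kappa> \<nu>" by (blast intro: dominates_trans)
    moreover have "\<kappa> \<noteq> \<nu>"
      using p(5) dominates_antisym[OF p(1,2,3)] p(4) by blast
    ultimately show "(\<kappa>, \<nu>) \<in> strict_dominance n"
      using * by (simp add: strict_dominance_def)
  qed
  then have "(strict_dominance n)\<^sup>+ = strict_dominance n"
    by (rule trancl_id)
  then show ?thesis
    by (simp add: acyclic_def strict_dominance_def)
qed

lemma dominance_induct_down [consumes 1, case_names step]:
  assumes "is_partition \<mu>"
    and step: "\<And>\<mu>. is_partition \<mu> \<Longrightarrow>
      (\<And>\<nu>. is_partition \<nu> \<Longrightarrow> sum_list \<nu> = sum_list \<mu> \<Longrightarrow> dominates \<nu> \<mu> \<Longrightarrow> \<nu> \<noteq> \<mu> \<Longrightarrow> P \<nu>) \<Longrightarrow> P \<mu>"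
  shows "P \<mu>"
proof -
  define n where "n = sum_list \<mu>"
  have "wf (strict_dominance n)"
    by (rule finite_acyclic_wf[OF finite_strict_dominance acyclic_strict_dominance])
  moreover have "\<mu> \<in> partitions_of n"
    unfolding n_def using assms(1) by (rule mem_partitions_of)
  ultimately show ?thesis
  proof (induction \<mu> rule: wf_induct_rule)
    case (less \<kappa>)
    then have \<kappa>: "is_partition \<kappa>" "sum_list \<kappa> = n"
      by (simp_all add: partitions_of_def)
    show ?case
    proof (rule step[OF \<kappa>(1)])
      fix \<nu> assume "is_partition \<nu>" "sum_list \<nu> = sum_list \<kappa>" "dominates \<nu> \<kappa>" "\<nu> \<noteq> \<kappa>"
      then show "P \<nu>"
        using less.prems \<kappa>(2) by (intro less.IH) (simp_all add: strict_dominance_def partitions_of_def)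
    qed
  qed
qed

lemma dominance_induct_up [consumes 1, case_names step]:
  assumes "is_partition \<mu>"
    and step: "\<And>\<mu>. is_partition \<mu> \<Longrightarrow>
      (\<And>\<nu>. is_partition \<nu> \<Longrightarrow> sum_list \<nu> = sum_list \<mu> \<Longrightarrow> dominates \<mu> \<nu> \<Longrightarrow> \<nu> \<noteq> \<mu> \<Longrightarrow> P \<nu>) \<Longrightarrow> P \<mu>"
  shows "P \<mu>"
proof -
  define n where "n = sum_list \<mu>"
  have "wf ((strict_dominance n)\<inverse>)"
    by (rule finite_acyclic_wf_converse[OF finite_strict_dominance acyclic_strict_dominance])
  moreover have "\<mu> \<in> partitions_of n"
    unfolding n_def using assms(1) by (rule mem_partitions_of)
  ultimately show ?thesis
  proof (induction \<mu> rule: wf_induct_rule)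
    case (less \<kappa>)
    then have \<kappa>: "is_partition \<kappa>" "sum_list \<kappa> = n"
      by (simp_all add: partitions_of_def)
    show ?case
    proof (rule step[OF \<kappa>(1)])
      fix \<nu> assume "is_partition \<nu>" "sum_list \<nu> = sum_list \<kappa>" "dominates \<kappa> \<nu>" "\<nu> \<noteq> \<kappa>"
      then show "P \<nu>"
        using less.prems \<kappa>(2) by (intro less.IH) (auto simp: strict_dominance_def partitions_of_def)
    qed
  qed
qed

section \<open>Unitriangular families\<close>

text \<open>
  The monomial whose exponents are the entries of the list. Lists are numbered from 0 and variables
  from 1, hence the shift.
\<close>

definition expo :: "nat list \<Rightarrow> monomial" where
  "expo xs = (\<Sum>i<length xs. Poly_Mapping.single (Suc i) (xs ! i))"

lemma lookup_expo:
  "Poly_Mapping.lookup (expo xs) v = (if 1 \<le> v \<and> v \<le> length xs then xs ! (v - 1) else 0)"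
proof -
  have "Poly_Mapping.lookup (expo xs) v = (\<Sum>i<length xs. if v = Suc i then xs ! i else 0)"
    unfolding expo_def lookup_sum lookup_single when_def by (rule sum.cong) auto
  also have "\<dots> = (if 1 \<le> v \<and> v \<le> length xs then xs ! (v - 1) else 0)"
  proof (cases v)
    case (Suc w)
    then show ?thesis by auto
  qed simp
  finally show ?thesis .
qed

lemma keys_expo: "Poly_Mapping.keys (expo xs) \<subseteq> {1..length xs}"
  by (auto simp: in_keys_iff lookup_expo split: if_splits)

lemma series_plus_apply: "(f + g) (\<alpha> :: monomial) = f \<alpha> + (g \<alpha> :: int)"
  by (rule plus_fun_apply)

lemma series_zero_apply: "(0 :: series) \<alpha> = 0"
  by (rule zero_fun_apply)

lemma series_sum_apply:
  assumes "finite S"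
  shows "sum F S (\<alpha> :: monomial) = (\<Sum>\<mu>\<in>S. F \<mu> \<alpha> :: int)"
  using assms
proof (induction S)
  case empty
  show ?case by (subst sum.empty, subst sum.empty) (rule series_zero_apply)
next
  case (insert \<mu> S)
  have "sum F (insert \<mu> S) \<alpha> = F \<mu> \<alpha> + sum F S \<alpha>"
    by (subst sum.insert[OF insert.hyps]) (rule series_plus_apply)
  then show ?case
    using insert by (metis sum.insert)
qed

lemma sum_series_apply:
  assumes "finite S"
  shows "(\<Sum>\<mu>\<in>S. series_scale (c \<mu>) (b \<mu>)) \<alpha> = (\<Sum>\<mu>\<in>S. c \<mu> * b \<mu> \<alpha>)"
  using series_sum_apply[OF assms, of "\<lambda>\<mu>. series_scale (c \<mu>) (b \<mu>)"] unfolding series_scale_def .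

text \<open>
  The common shape of the monomial and the Schur functions. Only the coefficients at monomials that
  belong to partitions matter, because symmetric series are determined by them.
\<close>

locale triangular_family =
  fixes b :: "nat list \<Rightarrow> series"
  assumes diagonal: "is_partition \<mu> \<Longrightarrow> b \<mu> (expo \<mu>) = 1"
    and off_diagonal: "is_partition \<mu> \<Longrightarrow> is_partition \<nu> \<Longrightarrow> b \<mu> (expo \<nu>) \<noteq> 0 \<Longrightarrow>
      sum_list \<mu> = sum_list \<nu> \<and> dominates \<mu> \<nu>"
begin

text \<open>
  Going down the dominance order, every earlier coefficient above \<open>\<mu>\<close> has already
  been shown to vanish, so the equation at the monomial of \<open>\<mu>\<close> reduces to
  \<open>c \<mu> = 0\<close>. With \<open>f = 0\<close> this is linear independence; in general it removes from an
  expansion every \<open>\<mu>\<close> such that \<open>f\<close> vanishes at \<open>\<mu>\<close> and above.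
\<close>

lemma coeff_eq_0:
  assumes S: "finite S" "S \<subseteq> Collect is_partition"
    and f: "\<And>\<nu>. is_partition \<nu> \<Longrightarrow> f (expo \<nu>) = (\<Sum>\<mu>\<in>S. c \<mu> * b \<mu> (expo \<nu>))"
    and "\<mu> \<in> S"
    and vanish: "\<And>\<nu>. is_partition \<nu> \<Longrightarrow> sum_list \<nu> = sum_list \<mu> \<Longrightarrow> dominates \<nu> \<mu> \<Longrightarrow> f (expo \<nu>) = 0"
  shows "c \<mu> = (0 :: int)"
proof -
  let ?vanish = "\<lambda>\<mu>. \<forall>\<nu>. is_partition \<nu> \<longrightarrow> sum_list \<nu> = sum_list \<mu> \<longrightarrow> dominates \<nu> \<mu> \<longrightarrow> f (expo \<nu>) = 0"
  have "is_partition \<mu>" using S(2) \<open>\<mu> \<in> S\<close> by blast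
  then have "\<mu> \<in> S \<longrightarrow> ?vanish \<mu> \<longrightarrow> c \<mu> = 0"
  proof (induction rule: dominance_induct_down)
    case (step \<mu>)
    show ?case
    proof (intro impI)
      assume prems: "\<mu> \<in> S" "?vanish \<mu>"
      have zero: "c \<kappa> * b \<kappa> (expo \<mu>) = 0" if \<kappa>: "\<kappa> \<in> S" "\<kappa> \<noteq> \<mu>" for \<kappa>
      proof (rule ccontr)
        assume nz: "c \<kappa> * b \<kappa> (expo \<mu>) \<noteq> 0"
        then have *: "sum_list \<kappa> = sum_list \<mu>" "dominates \<kappa> \<mu>" "is_partition \<kappa>"
          using off_diagonal[of \<kappa> \<mu>] step.hyps \<kappa>(1) S(2) by auto
        have "?vanish \<kappa>"
          using prems(2) *(1) dominates_trans[OF _ *(2)] by simp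
        then have "c \<kappa> = 0"
          using step.IH[OF *(3,1,2) \<kappa>(2)] \<kappa>(1) by blast
        then show False using nz by simp
      qed
      have rest: "(\<Sum>\<kappa>\<in>S - {\<mu>}. c \<kappa> * b \<kappa> (expo \<mu>)) = 0"
        by (rule sum.neutral) (use zero in blast)
      have "f (expo \<mu>) = 0"
        using prems(2) step.hyps dominates_refl[of \<mu>] by blast
      then have "0 = (\<Sum>\<kappa>\<in>S. c \<kappa> * b \<kappa> (expo \<mu>))"
        using f[OF step.hyps] by (rule trans[OF sym])
      also have "\<dots> = c \<mu> * b \<mu> (expo \<mu>) + (\<Sum>\<kappa>\<in>S - {\<mu>}. c \<kappa> * b \<kappa> (expo \<mu>))"
        using S(1) prems(1) by (rule sum.remove)
      also have "\<dots> = c \<mu>"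
        unfolding rest by (simp add: diagonal step.hyps)
      finally show "c \<mu> = 0" by simp
    qed
  qed
  then show ?thesis
    using \<open>\<mu> \<in> S\<close> vanish by blast
qed

lemma inj_on_partitions: "inj_on b (Collect is_partition)"
proof (rule inj_onI)
  fix \<mu> \<nu> assume *: "\<mu> \<in> Collect is_partition" "\<nu> \<in> Collect is_partition" "b \<mu> = b \<nu>"
  have p: "is_partition \<mu>" "is_partition \<nu>"
    using *(1,2) by simp_all
  have "b \<mu> (expo \<nu>) \<noteq> 0"
    unfolding *(3) diagonal[OF p(2)] by simp
  moreover have "b \<nu> (expo \<mu>) \<noteq> 0"
    unfolding *(3)[symmetric] diagonal[OF p(1)] by simp
  ultimately show "\<mu> = \<nu>"
    using off_diagonal p by (intro dominates_antisym) blast+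
qed

lemma independent_family: "series.independent (b ` Collect is_partition)"
proof
  assume "series.dependent (b ` Collect is_partition)"
  then obtain T u where T: "finite T" "T \<subseteq> b ` Collect is_partition"
    "(\<Sum>v\<in>T. series_scale (u v) v) = 0" "\<exists>v\<in>T. u v \<noteq> 0"
    unfolding series.dependent_explicit by blast
  obtain S where S: "S \<subseteq> Collect is_partition" "T = b ` S" "finite S"
    using T(1,2) by (meson finite_subset_image)
  have inj: "inj_on b S" using inj_on_partitions S(1) by (rule inj_on_subset)
  have sum0: "(\<Sum>\<mu>\<in>S. series_scale (u (b \<mu>)) (b \<mu>)) = 0"
    using T(3) unfolding S(2) sum.reindex[OF inj] comp_def .
  have "u (b \<mu>) = 0" if "\<mu> \<in> S" for \<mu>
  proof (rule coeff_eq_0[where f = "\<lambda>_. 0", OF \<open>finite S\<close> S(1) _ that])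
    show "0 = (\<Sum>\<mu>\<in>S. u (b \<mu>) * b \<mu> (expo \<nu>))" for \<nu>
      using fun_cong[OF sum0, of "expo \<nu>"] unfolding sum_series_apply[OF \<open>finite S\<close>] series_zero_apply by (rule sym)
  qed simp
  then show False using T(4) S(2) by blast
qed

lemma basis_coeff_expansion:
  assumes "finite S" "S \<subseteq> Collect is_partition" "is_partition \<mu>"
    and f: "f = (\<Sum>\<nu>\<in>S. series_scale (c \<nu>) (b \<nu>))"
  shows "basis_coeff b \<mu> f = (if \<mu> \<in> S then c \<mu> else 0)"
proof -
  let ?B = "b ` Collect is_partition"
  have in_B: "b \<nu> \<in> ?B" if "\<nu> \<in> S" for \<nu> using that assms by auto
  have "basis_coeff b \<mu> f = (\<Sum>\<nu>\<in>S. series.representation ?B (series_scale (c \<nu>) (b \<nu>)) (b \<mu>))"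
    unfolding basis_coeff_def f
    using in_B by (intro series.representation_sum[THEN fun_cong] independent_family
      series.span_scale[OF series.span_base])
  also have "\<dots> = (\<Sum>\<nu>\<in>S. if \<nu> = \<mu> then c \<nu> else 0)"
  proof (rule sum.cong)
    fix \<nu> assume "\<nu> \<in> S"
    then have "is_partition \<nu>" using assms by auto
    have "b \<mu> = b \<nu> \<longleftrightarrow> \<mu> = \<nu>"
      using inj_on_partitions \<open>is_partition \<nu>\<close> \<open>is_partition \<mu>\<close> by (auto dest: inj_onD)
    then show "series.representation ?B (series_scale (c \<nu>) (b \<nu>)) (b \<mu>) = (if \<nu> = \<mu> then c \<nu> else 0)"
      unfolding series.representation_scale[OF independent_family series.span_base[OF in_B[OF \<open>\<nu> \<in> S\<close>]]]
        series.representation_basis[OF independent_family in_B[OF \<open>\<nu> \<in> S\<close>]]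
      by auto
  qed simp
  also have "\<dots> = (if \<mu> \<in> S then c \<mu> else 0)"
    using assms(1) by simp
  finally show ?thesis .
qed

lemma expansion_in_span:
  assumes "f \<in> series.span (b ` Collect is_partition)"
  obtains S where "finite S" "S \<subseteq> Collect is_partition"
    "\<And>\<alpha>. f \<alpha> = (\<Sum>\<mu>\<in>S. basis_coeff b \<mu> f * b \<mu> \<alpha>)"
    "\<And>\<mu>. is_partition \<mu> \<Longrightarrow> \<mu> \<notin> S \<Longrightarrow> basis_coeff b \<mu> f = 0"
proof -
  obtain T r where T: "finite T" "T \<subseteq> b ` Collect is_partition" "f = (\<Sum>v\<in>T. series_scale (r v) v)"
    using assms unfolding series.span_explicit mem_Collect_eq by (elim exE conjE)
  obtain S where S: "S \<subseteq> Collect is_partition" "T = b ` S" "finite S"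
    using T(1,2) by (meson finite_subset_image)
  have inj: "inj_on b S" using inj_on_partitions S(1) by (rule inj_on_subset)
  have f: "f = (\<Sum>\<mu>\<in>S. series_scale (r (b \<mu>)) (b \<mu>))"
    using T(3) unfolding S(2) sum.reindex[OF inj] comp_def .
  have coeff: "basis_coeff b \<mu> f = (if \<mu> \<in> S then r (b \<mu>) else 0)" if "is_partition \<mu>" for \<mu>
    by (rule basis_coeff_expansion[OF \<open>finite S\<close> S(1) that f])
  show ?thesis
  proof (rule that[OF \<open>finite S\<close> S(1)])
    show "f \<alpha> = (\<Sum>\<mu>\<in>S. basis_coeff b \<mu> f * b \<mu> \<alpha>)" for \<alpha>
    proof -
      have "f \<alpha> = (\<Sum>\<mu>\<in>S. r (b \<mu>) * b \<mu> \<alpha>)"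
        by (subst f) (rule sum_series_apply[OF \<open>finite S\<close>])
      also have "\<dots> = (\<Sum>\<mu>\<in>S. basis_coeff b \<mu> f * b \<mu> \<alpha>)"
        using S(1) by (intro sum.cong) (auto simp: coeff)
      finally show ?thesis .
    qed
  qed (simp add: coeff)
qed

end

section \<open>Symmetric series\<close>

text \<open>
  Swapping neighboring exponents suffices, since such swaps generate all rearrangements; they are also
  the only ones that the Bender--Knuth involution handles directly.
\<close>

definition symmetric_series :: "series \<Rightarrow> bool" where
  "symmetric_series f \<longleftrightarrow> (\<forall>\<alpha>. \<not> Poly_Mapping.keys \<alpha> \<subseteq> {1..} \<longrightarrow> f \<alpha> = 0) \<and>
     (\<forall>us x y vs. f (expo (us @ x # y # vs)) = f (expo (us @ y # x # vs)))"

definition homogeneous_series :: "nat \<Rightarrow> series \<Rightarrow> bool" where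
  "homogeneous_series n f \<longleftrightarrow> (\<forall>xs. f (expo xs) \<noteq> 0 \<longrightarrow> sum_list xs = n)"

text \<open>
  Neighbor swaps bring any entry to the front; the rest is rearranged by induction, applied to
  \<open>h\<close> with that entry fixed.
\<close>

lemma invariant_under_rearrangement:
  assumes "\<And>us x y vs. h (us @ x # y # vs) = h (us @ y # x # vs)" "mset xs = mset ys"
  shows "h xs = h ys"
  using assms
proof (induction xs arbitrary: h ys)
  case (Cons x xs)
  have front: "h (us @ z # vs) = h (z # us @ vs)" for us z vs
  proof (induction us arbitrary: vs rule: rev_induct)
    case (snoc u us)
    have "h ((us @ [u]) @ z # vs) = h (us @ u # z # vs)" by simp
    also have "\<dots> = h (us @ z # u # vs)" by (rule Cons.prems(1))
    also have "\<dots> = h (z # us @ u # vs)" by (rule snoc.IH)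
    finally show ?case by simp
  qed simp
  have "x \<in> set ys" using Cons.prems(2) by (metis list.set_intros(1) mset_eq_setD)
  then obtain us vs where ys: "ys = us @ x # vs" by (meson split_list)
  have "mset xs = mset (us @ vs)" using Cons.prems(2) ys by simp
  moreover have "(\<lambda>zs. h (x # zs)) (us' @ x' # y # vs') = (\<lambda>zs. h (x # zs)) (us' @ y # x' # vs')" for us' x' y vs'
    using Cons.prems(1)[of "x # us'"] by simp
  ultimately have "h (x # xs) = h (x # us @ vs)"
    using Cons.IH[of "\<lambda>zs. h (x # zs)"] by blast
  then show ?case using front ys by simp
qed simp

lemma symmetric_series_mset:
  assumes "symmetric_series f" "mset xs = mset ys"
  shows "f (expo xs) = f (expo ys)"
  by (rule invariant_under_rearrangement[OF _ assms(2), of "\<lambda>xs. f (expo xs)"])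
    (use assms(1) in \<open>auto simp: symmetric_series_def\<close>)

lemma expo_append_zeros: "expo (xs @ replicate k 0) = expo xs"
  by (rule poly_mapping_eqI) (auto simp: lookup_expo nth_append)

lemma exponents_expo:
  "image_mset (Poly_Mapping.lookup (expo xs)) (mset_set (Poly_Mapping.keys (expo xs))) = filter_mset (\<lambda>x. x \<noteq> 0) (mset xs)"
proof -
  have keys: "Poly_Mapping.keys (expo xs) = {v \<in> Suc ` {..<length xs}. xs ! (v - 1) \<noteq> 0}"
    unfolding image_Suc_lessThan by (auto simp: in_keys_iff lookup_expo split: if_splits)
  have "mset_set (Poly_Mapping.keys (expo xs)) =
      filter_mset (\<lambda>v. xs ! (v - 1) \<noteq> 0) (image_mset Suc (mset_set {..<length xs}))"
    unfolding keys by (simp add: image_mset_mset_set filter_mset_mset_set)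
  also have "image_mset (Poly_Mapping.lookup (expo xs)) \<dots> =
      filter_mset (\<lambda>x. x \<noteq> 0) (image_mset (\<lambda>i. xs ! i) (mset_set {..<length xs}))"
    by (auto simp: filter_mset_image_mset image_mset.compositionality lookup_expo intro!: image_mset_cong)
  also have "image_mset (\<lambda>i. xs ! i) (mset_set {..<length xs}) = mset xs"
    by (metis lessThan_atLeast0 map_nth mset_map mset_set_upto_eq_mset_upto)
  finally show ?thesis .
qed

lemma exponents_expo_partition:
  "is_partition \<mu> \<Longrightarrow>
    image_mset (Poly_Mapping.lookup (expo \<mu>)) (mset_set (Poly_Mapping.keys (expo \<mu>))) = mset \<mu>"
  unfolding exponents_expo by (auto simp: is_partition_def filter_mset_eq_conv intro: gr0I)

lemma is_partition_eq_iff_mset: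
  assumes "is_partition \<mu>" "is_partition \<nu>"
  shows "mset \<mu> = mset \<nu> \<longleftrightarrow> \<mu> = \<nu>"
proof -
  have "sorted (rev \<mu>)" "sorted (rev \<nu>)"
    using assms by (auto simp: is_partition_def sorted_wrt_rev)
  then show ?thesis
    by (metis mset_rev properties_for_sort rev_rev_ident)
qed

lemma exists_partition_of_monomial:
  assumes "Poly_Mapping.keys \<alpha> \<subseteq> {1..}"
  obtains \<mu> xs where "is_partition \<mu>" "\<alpha> = expo xs" "mset xs = mset (\<mu> @ replicate (length xs - length \<mu>) 0)"
    "image_mset (Poly_Mapping.lookup \<alpha>) (mset_set (Poly_Mapping.keys \<alpha>)) = mset \<mu>"
proof -
  obtain N where N: "Poly_Mapping.keys \<alpha> \<subseteq> {..N}"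
    by (metis finite_keys finite_nat_iff_bounded_le)
  define xs where "xs = map (\<lambda>i. Poly_Mapping.lookup \<alpha> (Suc i)) [0..<N]"
  have \<alpha>: "\<alpha> = expo xs"
  proof (rule poly_mapping_eqI)
    fix v
    have "v \<notin> Poly_Mapping.keys \<alpha>" if "\<not> (1 \<le> v \<and> v \<le> N)"
      using that N assms by auto
    then show "Poly_Mapping.lookup \<alpha> v = Poly_Mapping.lookup (expo xs) v"
      by (auto simp: lookup_expo xs_def in_keys_iff)
  qed
  define \<mu> where "\<mu> = rev (sort (filter (\<lambda>x. x \<noteq> 0) xs))"
  have mset_\<mu>: "mset \<mu> = filter_mset (\<lambda>x. x \<noteq> 0) (mset xs)"
    by (simp add: \<mu>_def)
  have "sorted_wrt (\<ge>) \<mu>"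
    unfolding \<mu>_def by (subst sorted_wrt_rev) simp
  moreover have "0 \<notin> set \<mu>" by (simp add: \<mu>_def)
  ultimately have "is_partition \<mu>" by (simp add: is_partition_def)
  moreover have "mset xs = mset (\<mu> @ replicate (length xs - length \<mu>) 0)"
  proof -
    have split: "mset xs = mset \<mu> + filter_mset (\<lambda>x. \<not> x \<noteq> 0) (mset xs)"
      unfolding mset_\<mu> by (rule multiset_partition)
    moreover have zeros: "filter_mset (\<lambda>x. \<not> x \<noteq> 0) (mset xs) = replicate_mset (count (mset xs) 0) 0"
      by (simp add: filter_eq_replicate_mset eq_commute)
    moreover have "count (mset xs) 0 = length xs - length \<mu>"
      using arg_cong[OF split, of size] zeros by simp
    ultimately show ?thesis by simp
  qed
  moreover have "image_mset (Poly_Mapping.lookup \<alpha>) (mset_set (Poly_Mapping.keys \<alpha>)) = mset \<mu>"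
    unfolding \<alpha> exponents_expo mset_\<mu> ..
  ultimately show ?thesis using that \<alpha> by blast
qed

lemma keys_expo_positive: "Poly_Mapping.keys (expo xs) \<subseteq> {1..}"
  using keys_expo[of xs] by auto

lemma monomial_sym_expo:
  assumes "is_partition \<mu>" "is_partition \<nu>"
  shows "monomial_sym \<mu> (expo \<nu>) = of_bool (\<nu> = \<mu>)"
  unfolding monomial_sym_def exponents_expo_partition[OF assms(2)] is_partition_eq_iff_mset[OF assms(2,1)]
  using keys_expo_positive by simp

global_interpretation monomial: triangular_family monomial_sym
proof
  fix \<mu> \<nu> assume \<mu>: "is_partition \<mu>"
  then show "monomial_sym \<mu> (expo \<mu>) = 1"
    by (simp add: monomial_sym_expo)
  assume "is_partition \<nu>" "monomial_sym \<mu> (expo \<nu>) \<noteq> 0"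
  then have "\<mu> = \<nu>"
    using \<mu> by (simp add: monomial_sym_expo split: if_splits)
  then show "sum_list \<mu> = sum_list \<nu> \<and> dominates \<mu> \<nu>"
    by (simp add: dominates_refl)
qed

lemma symmetric_series_expansion:
  assumes "symmetric_series f" "homogeneous_series n f"
  shows "f = (\<Sum>\<mu>\<in>partitions_of n. series_scale (f (expo \<mu>)) (monomial_sym \<mu>))"
proof
  fix \<alpha>
  show "f \<alpha> = (\<Sum>\<mu>\<in>partitions_of n. series_scale (f (expo \<mu>)) (monomial_sym \<mu>)) \<alpha>"
  proof (cases "Poly_Mapping.keys \<alpha> \<subseteq> {1..}")
    case False
    then show ?thesis
      using assms(1) unfolding sum_series_apply[OF finite_partitions_of]
      by (simp add: monomial_sym_def symmetric_series_def)
  next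
    case True
    then obtain \<mu> xs where \<mu>: "is_partition \<mu>" "\<alpha> = expo xs"
      "mset xs = mset (\<mu> @ replicate (length xs - length \<mu>) 0)"
      "image_mset (Poly_Mapping.lookup \<alpha>) (mset_set (Poly_Mapping.keys \<alpha>)) = mset \<mu>"
      using exists_partition_of_monomial by metis
    have f\<alpha>: "f \<alpha> = f (expo \<mu>)"
      using symmetric_series_mset[OF assms(1) \<mu>(3)] \<mu>(2) by (simp add: expo_append_zeros)
    have "(\<Sum>\<nu>\<in>partitions_of n. f (expo \<nu>) * monomial_sym \<nu> \<alpha>) =
        (\<Sum>\<nu>\<in>partitions_of n. if \<nu> = \<mu> then f (expo \<mu>) else 0)"
      using True \<mu>(1,4)
      by (intro sum.cong) (auto simp: monomial_sym_def is_partition_eq_iff_mset partitions_of_def)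
    also have "\<dots> = f (expo \<mu>)"
      using assms(2) \<mu>(1) finite_partitions_of
      by (auto simp: homogeneous_series_def partitions_of_def)
    finally show ?thesis
      unfolding sum_series_apply[OF finite_partitions_of] using f\<alpha> by simp
  qed
qed

lemma basis_coeff_monomial:
  assumes "symmetric_series f" "homogeneous_series n f" "\<mu> \<in> partitions_of n"
  shows "basis_coeff monomial_sym \<mu> f = f (expo \<mu>)"
  using monomial.basis_coeff_expansion[OF finite_partitions_of _ _ symmetric_series_expansion[OF assms(1,2)], of \<mu>]
    assms(3) by (auto simp: partitions_of_def)

text \<open>
  By induction from the bottom of the dominance order each monomial function is
  \<open>b \<mu>\<close> minus a combination of lower monomial functions. No division is needed, because the
  diagonal coefficients are 1.
\<close>

lemma (in triangular_family) symmetric_series_in_span: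
  assumes b: "\<And>\<mu>. is_partition \<mu> \<Longrightarrow> symmetric_series (b \<mu>)"
    "\<And>\<mu>. is_partition \<mu> \<Longrightarrow> homogeneous_series (sum_list \<mu>) (b \<mu>)"
    and f: "symmetric_series f" "homogeneous_series n f"
  shows "f \<in> series.span (b ` Collect is_partition)"
proof -
  have "monomial_sym \<mu> \<in> series.span (b ` Collect is_partition)" if "is_partition \<mu>" for \<mu>
    using that
  proof (induction rule: dominance_induct_up)
    case (step \<mu>)
    let ?P = "partitions_of (sum_list \<mu>)"
    have "b \<mu> = (\<Sum>\<nu>\<in>?P. series_scale (b \<mu> (expo \<nu>)) (monomial_sym \<nu>))"
      using symmetric_series_expansion b step.hyps by blast
    also have "\<dots> = series_scale (b \<mu> (expo \<mu>)) (monomial_sym \<mu>) +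
        (\<Sum>\<nu>\<in>?P - {\<mu>}. series_scale (b \<mu> (expo \<nu>)) (monomial_sym \<nu>))"
      by (rule sum.remove[OF finite_partitions_of mem_partitions_of[OF step.hyps]])
    finally have "monomial_sym \<mu> = b \<mu> - (\<Sum>\<nu>\<in>?P - {\<mu>}. series_scale (b \<mu> (expo \<nu>)) (monomial_sym \<nu>))"
      unfolding diagonal[OF step.hyps] series.scale_one by (simp only: eq_diff_eq add.commute)
    also have "\<dots> \<in> series.span (b ` Collect is_partition)"
    proof (intro series.span_diff series.span_sum)
      show "b \<mu> \<in> series.span (b ` Collect is_partition)"
        using step.hyps by (auto intro: series.span_base)
      fix \<nu> assume \<nu>: "\<nu> \<in> ?P - {\<mu>}"
      show "series_scale (b \<mu> (expo \<nu>)) (monomial_sym \<nu>) \<in> series.span (b ` Collect is_partition)"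
      proof (cases "b \<mu> (expo \<nu>) = 0")
        case True
        show ?thesis
          unfolding True series.scale_zero_left by (rule series.span_zero)
      next
        case False
        moreover have "is_partition \<nu>" "\<nu> \<noteq> \<mu>"
          using \<nu> by (auto simp: partitions_of_def)
        ultimately show ?thesis
          using off_diagonal[OF step.hyps] by (intro series.span_scale step.IH) auto
      qed
    qed
    finally show ?case .
  qed
  then have "(\<Sum>\<mu>\<in>partitions_of n. series_scale (f (expo \<mu>)) (monomial_sym \<mu>)) \<in> series.span (b ` Collect is_partition)"
    by (intro series.span_sum series.span_scale) (simp add: partitions_of_def)
  then show ?thesis
    by (subst symmetric_series_expansion[OF f])
qed

section \<open>Gelfand--Tsetlin patterns\<close>

definition row :: "nat list \<Rightarrow> nat \<Rightarrow> nat" where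
  "row \<mu> i = (if i < length \<mu> then \<mu> ! i else 0)"

lemma row_antimono: "is_partition \<mu> \<Longrightarrow> i \<le> i' \<Longrightarrow> row \<mu> i' \<le> row \<mu> i"
  unfolding row_def is_partition_def
  by (cases "i = i'") (auto simp: sorted_wrt_iff_nth_less)

lemma sum_row: "(\<Sum>i<length \<mu>. row \<mu> i) = sum_list \<mu>"
  by (simp add: row_def sum_list_sum_nth atLeast0LessThan)

lemma young_diagram_Sigma: "young_diagram \<mu> = Sigma {..<length \<mu>} (\<lambda>i. {..<row \<mu> i})"
  by (auto simp: young_diagram_def row_def)

lemma finite_young_diagram: "finite (young_diagram \<mu>)"
  by (simp add: young_diagram_Sigma)

text \<open>
  A tableau is recorded by the shapes of its entries up to \<open>k\<close>, for each \<open>k\<close>: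
  \<open>g k i\<close> is the number of entries at most \<open>k\<close> in row \<open>i\<close>. Strict columns become the
  interlacing of consecutive shapes, and the entry \<open>k + 1\<close> is used \<open>xs ! k\<close> times. Levels
  beyond the last entry repeat the full shape, so that a tableau has exactly one pattern.
\<close>

definition gt_patterns :: "nat list \<Rightarrow> nat list \<Rightarrow> (nat \<Rightarrow> nat \<Rightarrow> nat) set" where
  "gt_patterns \<mu> xs = {g. g 0 = (\<lambda>_. 0) \<and> (\<forall>k\<ge>length xs. g k = row \<mu>) \<and>
     (\<forall>k i. g (Suc k) (Suc i) \<le> g k i \<and> g k i \<le> g (Suc k) i) \<and>
     (\<forall>k<length xs. (\<Sum>i<length \<mu>. g (Suc k) i) = (\<Sum>i<length \<mu>. g k i) + xs ! k)}"

definition pattern_of_tableau :: "nat list \<Rightarrow> (nat \<times> nat \<Rightarrow> nat) \<Rightarrow> nat \<Rightarrow> nat \<Rightarrow> nat" where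
  "pattern_of_tableau \<mu> T k i = card {j. j < row \<mu> i \<and> T (i, j) \<le> k}"

definition tableau_of_pattern :: "nat list \<Rightarrow> (nat \<Rightarrow> nat \<Rightarrow> nat) \<Rightarrow> nat \<times> nat \<Rightarrow> nat" where
  "tableau_of_pattern \<mu> g = (\<lambda>(i, j)\<in>young_diagram \<mu>. LEAST k. j < g k i)"

lemma initial_segment_eq_lessThan_card:
  assumes "finite A" "\<And>j j'. j' \<in> A \<Longrightarrow> j < j' \<Longrightarrow> j \<in> A"
  shows "A = {..<card A :: nat}"
proof -
  have "\<exists>m. m \<notin> A"
    using ex_new_if_finite[OF infinite_UNIV_nat assms(1)] .
  then have m: "(LEAST m. m \<notin> A) \<notin> A"
    by (rule LeastI_ex)
  define m where "m = (LEAST m. m \<notin> A)"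
  have below: "j \<in> A" if "j < m" for j
    using not_less_Least that unfolding m_def by blast
  have "A = {..<m}"
  proof (intro equalityI subsetI)
    fix j assume "j \<in> A"
    then show "j \<in> {..<m}"
      using m[folded m_def] assms(2)[of j m] by (cases j m rule: linorder_cases) auto
  qed (use below in auto)
  then show ?thesis by simp
qed

lemma less_pattern_of_tableau_iff:
  assumes "T \<in> ssyt \<mu>"
  shows "j < pattern_of_tableau \<mu> T k i \<longleftrightarrow> j < row \<mu> i \<and> T (i, j) \<le> k"
proof -
  let ?A = "{j. j < row \<mu> i \<and> T (i, j) \<le> k}"
  have "?A = {..<card ?A}"
  proof (rule initial_segment_eq_lessThan_card)
    fix j j' assume *: "j' \<in> ?A" "j < j'"
    then have "(i, j) \<in> young_diagram \<mu>" "(i, j') \<in> young_diagram \<mu>"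
      by (auto simp: young_diagram_def row_def split: if_splits)
    then have "T (i, j) \<le> T (i, j')"
      using assms *(2) unfolding ssyt_def by blast
    then show "j \<in> ?A" using * by auto
  qed simp
  then show ?thesis
    unfolding pattern_of_tableau_def by (metis (no_types, lifting) lessThan_iff mem_Collect_eq)
qed

lemma lookup_sum_var:
  assumes "finite D"
  shows "Poly_Mapping.lookup (\<Sum>c\<in>D. var (T c)) v = card {c \<in> D. T c = v}"
proof -
  have "Poly_Mapping.lookup (\<Sum>c\<in>D. var (T c)) v = (\<Sum>c\<in>D. if T c = v then 1 else 0)"
    unfolding lookup_sum by (rule sum.cong) (auto simp: var_def lookup_single when_def)
  also have "\<dots> = card {c \<in> D. T c = v}"
    using assms by (simp add: sum.If_cases Collect_conj_eq Int_commute)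
  finally show ?thesis .
qed

lemma pattern_of_tableau_Suc:
  "(\<Sum>i<length \<mu>. pattern_of_tableau \<mu> T (Suc k) i) =
     (\<Sum>i<length \<mu>. pattern_of_tableau \<mu> T k i) + card {c \<in> young_diagram \<mu>. T c = Suc k}"
proof -
  have "{c \<in> young_diagram \<mu>. T c = Suc k} = Sigma {..<length \<mu>} (\<lambda>i. {j. j < row \<mu> i \<and> T (i, j) = Suc k})"
    by (auto simp: young_diagram_Sigma)
  then have "card {c \<in> young_diagram \<mu>. T c = Suc k} = (\<Sum>i<length \<mu>. card {j. j < row \<mu> i \<and> T (i, j) = Suc k})"
    by (simp add: card_SigmaI)
  moreover have "pattern_of_tableau \<mu> T (Suc k) i = pattern_of_tableau \<mu> T k i + card {j. j < row \<mu> i \<and> T (i, j) = Suc k}" for i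
  proof -
    have "{j. j < row \<mu> i \<and> T (i, j) \<le> Suc k} = {j. j < row \<mu> i \<and> T (i, j) \<le> k} \<union> {j. j < row \<mu> i \<and> T (i, j) = Suc k}"
      by auto
    then show ?thesis
      unfolding pattern_of_tableau_def by (simp add: card_Un_disjoint disjoint_iff)
  qed
  ultimately show ?thesis by (simp add: sum.distrib)
qed

lemma ssyt_ge_1: "T \<in> ssyt \<mu> \<Longrightarrow> c \<in> young_diagram \<mu> \<Longrightarrow> 1 \<le> T c"
  unfolding ssyt_def using PiE_mem[of T "young_diagram \<mu>" "\<lambda>_. {1..}" c] by auto

lemma pattern_of_tableau_in_gt_patterns:
  assumes \<mu>: "is_partition \<mu>" and T: "T \<in> ssyt \<mu>"
    and content: "(\<Sum>c\<in>young_diagram \<mu>. var (T c)) = expo xs"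
  shows "pattern_of_tableau \<mu> T \<in> gt_patterns \<mu> xs"
proof -
  let ?g = "pattern_of_tableau \<mu> T"
  have count: "card {c \<in> young_diagram \<mu>. T c = v} = Poly_Mapping.lookup (expo xs) v" for v
    by (simp add: content[symmetric] lookup_sum_var finite_young_diagram)
  have cell: "(i, j) \<in> young_diagram \<mu> \<longleftrightarrow> j < row \<mu> i" for i j
    by (auto simp: young_diagram_def row_def)
  have "?g 0 i = 0" for i
    using less_pattern_of_tableau_iff[OF T, of 0 0 i] ssyt_ge_1[OF T, of "(i, 0)"] by (auto simp: cell)
  moreover have "?g k i = row \<mu> i" if "k \<ge> length xs" for k i
  proof -
    have "T c \<le> k" if "c \<in> young_diagram \<mu>" for c
    proof (rule ccontr)
      assume *: "\<not> T c \<le> k"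
      have "card {c' \<in> young_diagram \<mu>. T c' = T c} = 0"
        using * \<open>k \<ge> length xs\<close> by (simp add: count lookup_expo)
      then have "{c' \<in> young_diagram \<mu>. T c' = T c} = {}"
        using finite_young_diagram by (subst (asm) card_eq_0_iff) simp
      then show False using that by blast
    qed
    then have "{j. j < row \<mu> i \<and> T (i, j) \<le> k} = {..<row \<mu> i}"
      by (auto simp: cell)
    then show ?thesis by (simp add: pattern_of_tableau_def)
  qed
  moreover have "?g (Suc k) (Suc i) \<le> ?g k i" for k i
  proof (rule ccontr)
    assume "\<not> ?thesis"
    then have "?g k i < ?g (Suc k) (Suc i)" by simp
    then have *: "?g k i < row \<mu> (Suc i)" "T (Suc i, ?g k i) \<le> Suc k"
      unfolding less_pattern_of_tableau_iff[OF T] by auto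
    moreover have r: "?g k i < row \<mu> i"
      using * row_antimono[OF \<mu>, of i "Suc i"] by simp
    ultimately have "T (i, ?g k i) < T (Suc i, ?g k i)"
      using T cell unfolding ssyt_def by blast
    then have "?g k i < ?g k i"
      using * r by (subst less_pattern_of_tableau_iff[OF T]) auto
    then show False by simp
  qed
  moreover have "?g k i \<le> ?g (Suc k) i" for k i
    unfolding pattern_of_tableau_def by (rule card_mono) auto
  moreover have "(\<Sum>i<length \<mu>. ?g (Suc k) i) = (\<Sum>i<length \<mu>. ?g k i) + xs ! k" if "k < length xs" for k
    using that by (simp add: pattern_of_tableau_Suc count lookup_expo)
  ultimately show ?thesis
    unfolding gt_patterns_def by auto
qed

lemma gt_patterns_mono:
  assumes "g \<in> gt_patterns \<mu> xs" "k \<le> k'"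
  shows "g k i \<le> g k' i"
  using assms(2) by (rule lift_Suc_mono_le[rotated]) (use assms(1) in \<open>auto simp: gt_patterns_def\<close>)

lemma gt_patterns_le_row: "g \<in> gt_patterns \<mu> xs \<Longrightarrow> g k i \<le> row \<mu> i"
  using gt_patterns_mono[of g \<mu> xs k "max k (length xs)" i] by (auto simp: gt_patterns_def)

lemma gt_patterns_antimono:
  assumes g: "g \<in> gt_patterns \<mu> xs" and "i \<le> i'"
  shows "g k i' \<le> g k i"
  using assms(2)
proof (rule lift_Suc_antimono_le[rotated])
  fix i
  have "g k (Suc i) \<le> g (Suc k) (Suc i)" "g (Suc k) (Suc i) \<le> g k i"
    using g unfolding gt_patterns_def by blast+
  then show "g k (Suc i) \<le> g k i" by simp
qed

lemma tableau_of_pattern_le_iff: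
  assumes g: "g \<in> gt_patterns \<mu> xs" and c: "(i, j) \<in> young_diagram \<mu>"
  shows "tableau_of_pattern \<mu> g (i, j) \<le> k \<longleftrightarrow> j < g k i"
proof -
  have "j < g (length xs) i"
    using g c by (auto simp: gt_patterns_def row_def young_diagram_def)
  then have least: "j < g (LEAST k. j < g k i) i"
    by (rule LeastI)
  have T: "tableau_of_pattern \<mu> g (i, j) = (LEAST k. j < g k i)"
    using c by (simp add: tableau_of_pattern_def)
  show ?thesis
    unfolding T using least gt_patterns_mono[OF g] by (metis Least_le order_less_le_trans)
qed

lemma tableau_of_pattern_in_ssyt:
  assumes g: "g \<in> gt_patterns \<mu> xs"
  shows "tableau_of_pattern \<mu> g \<in> ssyt \<mu>"
proof -
  let ?T = "tableau_of_pattern \<mu> g"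
  note le_iff = tableau_of_pattern_le_iff[OF g]
  have pos: "1 \<le> ?T (i, j)" if "(i, j) \<in> young_diagram \<mu>" for i j
    using le_iff[OF that, of 0] g by (auto simp: gt_patterns_def)
  have "?T (i, j) \<le> ?T (i, j')" if "(i, j) \<in> young_diagram \<mu>" "(i, j') \<in> young_diagram \<mu>" "j < j'" for i j j'
    using le_iff[OF that(1)] le_iff[OF that(2), of "?T (i, j')"] that(3) by auto
  moreover have "?T (i, j) < ?T (i', j)" if c: "(i, j) \<in> young_diagram \<mu>" "(i', j) \<in> young_diagram \<mu>" "i < i'" for i i' j
  proof -
    obtain k where k: "?T (i', j) = Suc k"
      using pos[OF c(2)] by (cases "?T (i', j)") auto
    obtain h where h: "i' = Suc h" using c(3) by (cases i') auto
    have "j < g (Suc k) (Suc h)"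
      using le_iff[OF c(2), of "Suc k"] k h by simp
    also have "\<dots> \<le> g k h"
      using g unfolding gt_patterns_def by blast
    also have "\<dots> \<le> g k i"
      using gt_patterns_antimono[OF g] c(3) h by simp
    finally show ?thesis
      using le_iff[OF c(1), of k] k by simp
  qed
  moreover have "?T \<in> young_diagram \<mu> \<rightarrow>\<^sub>E {1..}"
  proof (rule PiE_I)
    fix c assume "c \<in> young_diagram \<mu>"
    then show "?T c \<in> {1..}" using pos by (cases c) auto
  qed (simp add: tableau_of_pattern_def)
  ultimately show ?thesis unfolding ssyt_def by blast
qed

lemma pattern_of_tableau_of_pattern:
  assumes g: "g \<in> gt_patterns \<mu> xs"
  shows "pattern_of_tableau \<mu> (tableau_of_pattern \<mu> g) = g"
proof (intro ext)
  fix k i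
  have "{j. j < row \<mu> i \<and> tableau_of_pattern \<mu> g (i, j) \<le> k} = {..<g k i}"
    using tableau_of_pattern_le_iff[OF g, of i] gt_patterns_le_row[OF g, of k i]
    by (auto simp: young_diagram_Sigma row_def split: if_splits)
  then show "pattern_of_tableau \<mu> (tableau_of_pattern \<mu> g) k i = g k i"
    by (simp add: pattern_of_tableau_def)
qed

lemma tableau_of_pattern_of_tableau:
  assumes T: "T \<in> ssyt \<mu>" and g: "pattern_of_tableau \<mu> T \<in> gt_patterns \<mu> xs"
  shows "tableau_of_pattern \<mu> (pattern_of_tableau \<mu> T) = T"
proof
  fix c :: "nat \<times> nat"
  obtain i j :: nat where c: "c = (i, j)" by (cases c)
  show "tableau_of_pattern \<mu> (pattern_of_tableau \<mu> T) c = T c"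
  proof (cases "c \<in> young_diagram \<mu>")
    case True
    then have "j < row \<mu> i" by (auto simp: c young_diagram_def row_def)
    then have "tableau_of_pattern \<mu> (pattern_of_tableau \<mu> T) c \<le> k \<longleftrightarrow> T c \<le> k" for k
      using True tableau_of_pattern_le_iff[OF g] less_pattern_of_tableau_iff[OF T] unfolding c by blast
    then show ?thesis by (meson le_refl order_antisym)
  next
    case False
    then have "T c = undefined" using T PiE_arb unfolding ssyt_def by blast
    then show ?thesis using False by (simp add: tableau_of_pattern_def restrict_def)
  qed
qed

lemma content_tableau_of_pattern:
  assumes g: "g \<in> gt_patterns \<mu> xs"
  shows "(\<Sum>c\<in>young_diagram \<mu>. var (tableau_of_pattern \<mu> g c)) = expo xs"
proof (rule poly_mapping_eqI)
  fix v
  let ?T = "tableau_of_pattern \<mu> g"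
  have "card {c \<in> young_diagram \<mu>. ?T c = v} = Poly_Mapping.lookup (expo xs) v"
  proof (cases v)
    case 0
    have "{c \<in> young_diagram \<mu>. ?T c = v} = {}"
      using ssyt_ge_1[OF tableau_of_pattern_in_ssyt[OF g]] 0 by force
    then show ?thesis using 0 by (simp only: card.empty) (simp add: lookup_expo)
  next
    case (Suc k)
    have step: "(\<Sum>i<length \<mu>. g (Suc k) i) = (\<Sum>i<length \<mu>. g k i) + card {c \<in> young_diagram \<mu>. ?T c = Suc k}"
      using pattern_of_tableau_Suc[of \<mu> ?T k] by (simp only: pattern_of_tableau_of_pattern[OF g])
    show ?thesis
    proof (cases "k < length xs")
      case True
      then have "(\<Sum>i<length \<mu>. g (Suc k) i) = (\<Sum>i<length \<mu>. g k i) + xs ! k"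
        using g unfolding gt_patterns_def by blast
      then show ?thesis using step True Suc by (simp add: lookup_expo)
    next
      case False
      then have "g (Suc k) = g k"
        using g unfolding gt_patterns_def by simp
      then show ?thesis using step False Suc by (simp add: lookup_expo)
    qed
  qed
  then show "Poly_Mapping.lookup (\<Sum>c\<in>young_diagram \<mu>. var (?T c)) v = Poly_Mapping.lookup (expo xs) v"
    by (simp add: lookup_sum_var finite_young_diagram)
qed

text \<open>
  Patterns replace tableaux from here on, because the symmetry and the triangularity of Schur
  functions are visible on the levels of a pattern.
\<close>

lemma schur_expo:
  assumes \<mu>: "is_partition \<mu>"
  shows "schur \<mu> (expo xs) = int (card (gt_patterns \<mu> xs))"
proof -
  have "bij_betw (pattern_of_tableau \<mu>) {T \<in> ssyt \<mu>. (\<Sum>c\<in>young_diagram \<mu>. var (T c)) = expo xs} (gt_patterns \<mu> xs)"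
  proof (rule bij_betw_byWitness[where f' = "tableau_of_pattern \<mu>"])
    show "\<forall>T\<in>{T \<in> ssyt \<mu>. (\<Sum>c\<in>young_diagram \<mu>. var (T c)) = expo xs}.
        tableau_of_pattern \<mu> (pattern_of_tableau \<mu> T) = T"
      using tableau_of_pattern_of_tableau pattern_of_tableau_in_gt_patterns[OF \<mu>] by blast
    show "\<forall>g\<in>gt_patterns \<mu> xs. pattern_of_tableau \<mu> (tableau_of_pattern \<mu> g) = g"
      using pattern_of_tableau_of_pattern by blast
    show "pattern_of_tableau \<mu> ` {T \<in> ssyt \<mu>. (\<Sum>c\<in>young_diagram \<mu>. var (T c)) = expo xs} \<subseteq> gt_patterns \<mu> xs"
      using pattern_of_tableau_in_gt_patterns[OF \<mu>] by blast
    show "tableau_of_pattern \<mu> ` gt_patterns \<mu> xs \<subseteq> {T \<in> ssyt \<mu>. (\<Sum>c\<in>young_diagram \<mu>. var (T c)) = expo xs}"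
      using tableau_of_pattern_in_ssyt content_tableau_of_pattern by blast
  qed
  then show ?thesis
    unfolding schur_def by (simp add: bij_betw_same_card)
qed

lemma gt_patterns_interlace:
  "g \<in> gt_patterns \<mu> xs \<Longrightarrow> g (Suc k) (Suc i) \<le> g k i"
  "g \<in> gt_patterns \<mu> xs \<Longrightarrow> g k i \<le> g (Suc k) i"
  by (simp_all add: gt_patterns_def)

lemma gt_patterns_sum_Suc:
  "g \<in> gt_patterns \<mu> xs \<Longrightarrow> k < length xs \<Longrightarrow>
    (\<Sum>i<length \<mu>. g (Suc k) i) = (\<Sum>i<length \<mu>. g k i) + xs ! k"
  by (simp add: gt_patterns_def)

text \<open>
  If the levels \<open>P\<close> and \<open>Q\<close> of a pattern have one level between them, its entries can be
  chosen independently of each other, each from the interval between these two bounds.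
\<close>

definition level_lower :: "(nat \<Rightarrow> nat) \<Rightarrow> (nat \<Rightarrow> nat) \<Rightarrow> nat \<Rightarrow> nat" where
  "level_lower P Q i = max (P i) (Q (Suc i))"

definition level_upper :: "(nat \<Rightarrow> nat) \<Rightarrow> (nat \<Rightarrow> nat) \<Rightarrow> nat \<Rightarrow> nat" where
  "level_upper P Q i = (case i of 0 \<Rightarrow> Q 0 | Suc j \<Rightarrow> min (Q i) (P j))"

text \<open>
  The Bender--Knuth involution in terms of patterns: reflect each entry of one level in the interval
  of its possible values.
\<close>

definition bender_knuth :: "nat \<Rightarrow> (nat \<Rightarrow> nat \<Rightarrow> nat) \<Rightarrow> nat \<Rightarrow> nat \<Rightarrow> nat" where
  "bender_knuth p g = g(Suc p := (\<lambda>i.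
     level_lower (g p) (g (Suc (Suc p))) i + level_upper (g p) (g (Suc (Suc p))) i - g (Suc p) i))"

text \<open>
  The upper bound in row \<open>i + 1\<close> and the lower bound in row \<open>i\<close> are the minimum and the
  maximum of the same two numbers, so the sum telescopes. Hence reflecting a level exchanges its
  differences to the two adjacent levels, which are the multiplicities of two consecutive entries.
\<close>

lemma sum_level_bounds:
  "(\<Sum>i<Suc m. level_lower P Q i + level_upper P Q i) =
     (\<Sum>i<m. P i) + (\<Sum>i<Suc m. Q i) + level_lower P Q m"
proof (induction m)
  case 0
  then show ?case by (simp add: level_upper_def)
next
  case (Suc m)
  have "level_lower P Q m + level_upper P Q (Suc m) = P m + Q (Suc m)"
    by (simp add: level_lower_def level_upper_def max_def min_def)
  then show ?case using Suc.IH by simp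
qed

lemma level_bounds:
  assumes "g \<in> gt_patterns \<mu> xs"
  shows "level_lower (g p) (g (Suc (Suc p))) i \<le> g (Suc p) i"
    "g (Suc p) i \<le> level_upper (g p) (g (Suc (Suc p))) i"
  using gt_patterns_interlace[OF assms]
  by (auto simp: level_lower_def level_upper_def split: nat.split)

lemma bender_knuth_in_gt_patterns:
  assumes g: "g \<in> gt_patterns \<mu> (us @ x # y # vs)"
  shows "bender_knuth (length us) g \<in> gt_patterns \<mu> (us @ y # x # vs)"
proof -
  let ?p = "length us"
  let ?P = "g ?p" and ?Q = "g (Suc (Suc ?p))"
  let ?h = "bender_knuth ?p g"
  have h_same: "?h k = g k" if "k \<noteq> Suc ?p" for k
    using that by (simp add: bender_knuth_def)
  have h_refl: "?h (Suc ?p) i + g (Suc ?p) i = level_lower ?P ?Q i + level_upper ?P ?Q i" for i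
    using level_bounds[OF g, of ?p i] by (simp add: bender_knuth_def)
  have h_bounds: "level_lower ?P ?Q i \<le> ?h (Suc ?p) i" "?h (Suc ?p) i \<le> level_upper ?P ?Q i" for i
    using level_bounds[OF g, of ?p i] h_refl[of i] by linarith+
  have sum_h: "(\<Sum>i<length \<mu>. ?h (Suc ?p) i) + (\<Sum>i<length \<mu>. g (Suc ?p) i) =
      (\<Sum>i<length \<mu>. ?P i) + (\<Sum>i<length \<mu>. ?Q i)"
  proof (cases "length \<mu>")
    case (Suc m)
    have "?Q (Suc m) = 0"
      using gt_patterns_le_row[OF g, of "Suc (Suc ?p)" "Suc m"] Suc by (simp add: row_def)
    then have "level_lower ?P ?Q m = ?P m"
      by (simp add: level_lower_def)
    moreover have "(\<Sum>i<length \<mu>. ?h (Suc ?p) i) + (\<Sum>i<length \<mu>. g (Suc ?p) i) =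
        (\<Sum>i<length \<mu>. level_lower ?P ?Q i + level_upper ?P ?Q i)"
      by (simp only: sum.distrib[symmetric] h_refl)
    ultimately show ?thesis
      unfolding Suc sum_level_bounds by simp
  qed simp
  have sum_p: "(\<Sum>i<length \<mu>. g (Suc ?p) i) = (\<Sum>i<length \<mu>. ?P i) + x"
    using gt_patterns_sum_Suc[OF g, of ?p] by simp
  have sum_Sp: "(\<Sum>i<length \<mu>. ?Q i) = (\<Sum>i<length \<mu>. g (Suc ?p) i) + y"
    using gt_patterns_sum_Suc[OF g, of "Suc ?p"] by (simp add: nth_append)
  have "?h 0 = (\<lambda>_. 0)"
    using g by (simp add: h_same gt_patterns_def)
  moreover have "?h k = row \<mu>" if "k \<ge> length (us @ y # x # vs)" for k
    using g that by (simp add: h_same gt_patterns_def)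
  moreover have "?h (Suc k) (Suc i) \<le> ?h k i \<and> ?h k i \<le> ?h (Suc k) i" for k i
  proof -
    consider "k = ?p" | "k = Suc ?p" | "k \<noteq> ?p" "k \<noteq> Suc ?p" by blast
    then show ?thesis
    proof cases
      case 1
      have "?h (Suc ?p) (Suc i) \<le> ?P i"
        using h_bounds(2)[of "Suc i"] by (simp add: level_upper_def)
      moreover have "?P i \<le> ?h (Suc ?p) i"
        using h_bounds(1)[of i] by (simp add: level_lower_def)
      ultimately show ?thesis
        unfolding 1 by (simp add: h_same)
    next
      case 2
      have "?Q (Suc i) \<le> ?h (Suc ?p) i"
        using h_bounds(1)[of i] by (simp add: level_lower_def)
      moreover have "?h (Suc ?p) i \<le> ?Q i"
        using h_bounds(2)[of i] by (cases i) (simp_all add: level_upper_def)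
      ultimately show ?thesis
        unfolding 2 by (simp add: h_same)
    next
      case 3
      then show ?thesis
        using gt_patterns_interlace[OF g, of k i] by (simp add: h_same)
    qed
  qed
  moreover have "(\<Sum>i<length \<mu>. ?h (Suc k) i) = (\<Sum>i<length \<mu>. ?h k i) + (us @ y # x # vs) ! k"
    if k: "k < length (us @ y # x # vs)" for k
  proof -
    consider "k = ?p" | "k = Suc ?p" | "k \<noteq> ?p" "k \<noteq> Suc ?p" by blast
    then show ?thesis
    proof cases
      case 1
      then show ?thesis
        using sum_h sum_p sum_Sp by (simp add: h_same)
    next
      case 2
      then show ?thesis
        using sum_h sum_p sum_Sp by (simp add: h_same nth_append)
    next
      case 3
      then have "(us @ y # x # vs) ! k = (us @ x # y # vs) ! k"
        by (auto simp: nth_append nth_Cons split: nat.split)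
      then show ?thesis
        using 3 gt_patterns_sum_Suc[OF g, of k] k by (simp add: h_same)
    qed
  qed
  ultimately show ?thesis
    unfolding gt_patterns_def by blast
qed

lemma bender_knuth_involution:
  assumes g: "g \<in> gt_patterns \<mu> xs"
  shows "bender_knuth p (bender_knuth p g) = g"
proof (intro ext)
  fix k i
  show "bender_knuth p (bender_knuth p g) k i = g k i"
    using level_bounds[OF g, of p i] by (simp add: bender_knuth_def)
qed

lemma card_gt_patterns_swap:
  "card (gt_patterns \<mu> (us @ x # y # vs)) = card (gt_patterns \<mu> (us @ y # x # vs))"
proof (rule bij_betw_same_card)
  show "bij_betw (bender_knuth (length us)) (gt_patterns \<mu> (us @ x # y # vs)) (gt_patterns \<mu> (us @ y # x # vs))"
    by (rule bij_betw_byWitness[where f' = "bender_knuth (length us)"])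
      (use bender_knuth_involution bender_knuth_in_gt_patterns in blast)+
qed

lemma gt_patterns_sum:
  assumes g: "g \<in> gt_patterns \<mu> xs"
  shows "(\<Sum>i<length \<mu>. g k i) = sum_list (take k xs)"
proof (induction k)
  case 0
  then show ?case using g by (simp add: gt_patterns_def)
next
  case (Suc k)
  show ?case
  proof (cases "k < length xs")
    case True
    then show ?thesis
      using gt_patterns_sum_Suc[OF g True] Suc.IH by (simp add: take_Suc_conv_app_nth)
  next
    case False
    then have "g (Suc k) = g k" using g by (simp add: gt_patterns_def)
    then show ?thesis using Suc.IH False by simp
  qed
qed

lemma gt_patterns_sum_list: "g \<in> gt_patterns \<mu> xs \<Longrightarrow> sum_list xs = sum_list \<mu>"
  using gt_patterns_sum[of g \<mu> xs "length xs"] by (simp add: gt_patterns_def sum_row)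

lemma gt_patterns_eq_0:
  assumes g: "g \<in> gt_patterns \<mu> xs" and "k \<le> i"
  shows "g k i = 0"
  using \<open>k \<le> i\<close>
proof (induction k arbitrary: i)
  case 0
  then show ?case using g by (simp add: gt_patterns_def)
next
  case (Suc k)
  then obtain j where "i = Suc j" "k \<le> j" by (cases i) auto
  then show ?case
    using Suc.IH[of j] gt_patterns_interlace(1)[OF g, of k j] by simp
qed

text \<open>
  The pattern of the tableau whose row \<open>i\<close> consists of entries \<open>i + 1\<close> only.
\<close>

definition full_pattern :: "nat list \<Rightarrow> nat \<Rightarrow> nat \<Rightarrow> nat" where
  "full_pattern \<mu> k i = (if i < k then row \<mu> i else 0)"

lemma sum_full_pattern: "(\<Sum>i<length \<mu>. full_pattern \<mu> k i) = sum_list (take k \<mu>)"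
proof -
  have "(\<Sum>i<length \<mu>. full_pattern \<mu> k i) = (\<Sum>i\<in>{..<length \<mu>} \<inter> {..<k}. row \<mu> i)"
    by (simp add: full_pattern_def sum.If_cases lessThan_def)
  also have "\<dots> = (\<Sum>i<length (take k \<mu>). take k \<mu> ! i)"
    by (rule sum.cong) (auto simp: row_def)
  also have "\<dots> = sum_list (take k \<mu>)"
    by (simp only: sum_list_sum_nth atLeast0LessThan)
  finally show ?thesis .
qed

lemma gt_patterns_le_full:
  assumes "g \<in> gt_patterns \<mu> xs"
  shows "g k i \<le> full_pattern \<mu> k i"
  using gt_patterns_le_row[OF assms] gt_patterns_eq_0[OF assms, of k i] by (auto simp: full_pattern_def)

lemma gt_patterns_dominates:
  assumes "g \<in> gt_patterns \<mu> xs"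
  shows "dominates \<mu> xs"
  unfolding dominates_def
proof (intro allI impI)
  fix k
  have "sum_list (take k xs) = (\<Sum>i<length \<mu>. g k i)"
    by (rule gt_patterns_sum[OF assms, symmetric])
  also have "\<dots> \<le> (\<Sum>i<length \<mu>. full_pattern \<mu> k i)"
    by (intro sum_mono gt_patterns_le_full[OF assms])
  finally show "sum_list (take k xs) \<le> sum_list (take k \<mu>)"
    by (simp only: sum_full_pattern)
qed

text \<open>
  The full pattern is an upper bound for every entry. If a level has the same total as the full
  pattern, it must agree with it.
\<close>

lemma gt_patterns_full_level:
  assumes g: "g \<in> gt_patterns \<mu> xs" and eq: "sum_list (take k xs) = sum_list (take k \<mu>)"
  shows "g k = full_pattern \<mu> k"
proof
  fix i
  show "g k i = full_pattern \<mu> k i"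
  proof (cases "i < length \<mu>")
    case True
    have "(\<Sum>i<length \<mu>. g k i) = (\<Sum>i<length \<mu>. full_pattern \<mu> k i)"
      unfolding gt_patterns_sum[OF g] sum_full_pattern eq ..
    then show ?thesis
      using True gt_patterns_le_full[OF g] by (intro sum_mono_inv[of "g k" "{..<length \<mu>}"]) auto
  next
    case False
    then show ?thesis
      using gt_patterns_le_row[OF g, of k i] by (simp add: full_pattern_def row_def)
  qed
qed

lemma full_pattern_in_gt_patterns:
  assumes "is_partition \<mu>"
  shows "full_pattern \<mu> \<in> gt_patterns \<mu> \<mu>"
proof -
  have "full_pattern \<mu> k = row \<mu>" if "k \<ge> length \<mu>" for k
    using that by (auto simp: full_pattern_def row_def)
  moreover have "full_pattern \<mu> (Suc k) (Suc i) \<le> full_pattern \<mu> k i \<and> full_pattern \<mu> k i \<le> full_pattern \<mu> (Suc k) i" for k i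
    using row_antimono[OF assms, of i "Suc i"] by (simp add: full_pattern_def)
  moreover have "full_pattern \<mu> 0 = (\<lambda>_. 0)"
    by (auto simp: full_pattern_def)
  moreover have "(\<Sum>i<length \<mu>. full_pattern \<mu> (Suc k) i) = (\<Sum>i<length \<mu>. full_pattern \<mu> k i) + \<mu> ! k"
    if "k < length \<mu>" for k
    using that by (simp only: sum_full_pattern) (simp add: take_Suc_conv_app_nth)
  ultimately show ?thesis
    unfolding gt_patterns_def by blast
qed

lemma gt_patterns_diagonal:
  assumes "is_partition \<mu>"
  shows "gt_patterns \<mu> \<mu> = {full_pattern \<mu>}"
proof (intro equalityI subsetI)
  fix g assume "g \<in> gt_patterns \<mu> \<mu>"
  then have "g k = full_pattern \<mu> k" for k
    by (rule gt_patterns_full_level) simp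
  then show "g \<in> {full_pattern \<mu>}" by auto
qed (use full_pattern_in_gt_patterns[OF assms] in simp)

section \<open>Schur functions\<close>

lemma symmetric_series_schur:
  assumes "is_partition \<mu>"
  shows "symmetric_series (schur \<mu>)"
proof -
  have "schur \<mu> \<alpha> = 0" if "\<not> Poly_Mapping.keys \<alpha> \<subseteq> {1..}" for \<alpha>
  proof -
    from that have 0: "Poly_Mapping.lookup \<alpha> 0 \<noteq> 0"
      by (metis atLeast_iff in_keys_iff less_one not_le subsetI)
    have "(\<Sum>c\<in>young_diagram \<mu>. var (T c)) \<noteq> \<alpha>" if "T \<in> ssyt \<mu>" for T
    proof
      assume "(\<Sum>c\<in>young_diagram \<mu>. var (T c)) = \<alpha>"
      then have "card {c \<in> young_diagram \<mu>. T c = 0} \<noteq> 0"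
        using 0 lookup_sum_var[OF finite_young_diagram, of T \<mu> 0] by simp
      moreover have "{c \<in> young_diagram \<mu>. T c = 0} = {}"
        using ssyt_ge_1[OF that] by fastforce
      ultimately show False by (simp only: card.empty)
    qed
    then have "{T \<in> ssyt \<mu>. (\<Sum>c\<in>young_diagram \<mu>. var (T c)) = \<alpha>} = {}" by blast
    then show ?thesis unfolding schur_def by (simp only: card.empty of_nat_0)
  qed
  then show ?thesis
    unfolding symmetric_series_def schur_expo[OF assms] card_gt_patterns_swap by blast
qed

lemma homogeneous_series_schur:
  assumes "is_partition \<mu>"
  shows "homogeneous_series (sum_list \<mu>) (schur \<mu>)"
  unfolding homogeneous_series_def schur_expo[OF assms]
  using gt_patterns_sum_list by (metis card.empty ex_in_conv of_nat_0)

global_interpretation schur: triangular_family schur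
proof
  fix \<mu> \<nu> assume \<mu>: "is_partition \<mu>"
  show "schur \<mu> (expo \<mu>) = 1"
    by (simp add: schur_expo[OF \<mu>] gt_patterns_diagonal[OF \<mu>])
  assume "schur \<mu> (expo \<nu>) \<noteq> 0"
  then obtain g where "g \<in> gt_patterns \<mu> \<nu>"
    unfolding schur_expo[OF \<mu>] by (metis card.empty ex_in_conv of_nat_0)
  then show "sum_list \<mu> = sum_list \<nu> \<and> dominates \<mu> \<nu>"
    using gt_patterns_sum_list gt_patterns_dominates by metis
qed

definition three_row_pattern :: "nat list \<Rightarrow> nat \<Rightarrow> nat \<times> nat \<Rightarrow> nat \<Rightarrow> nat \<Rightarrow> nat" where
  "three_row_pattern \<mu> u = (\<lambda>(a, b) k. if k = 1 then (\<lambda>i. if i = 0 then u else 0)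
     else if k = 2 then (\<lambda>i. if i = 0 then a else if i = 1 then b else 0)
     else full_pattern \<mu> k)"

text \<open>
  From level 3 on the totals are the largest possible, so these levels are forced; level 1 has a
  single entry. All freedom is in the two entries \<open>a\<close> and \<open>b\<close> of level 2.
\<close>

lemma gt_patterns_three_rows:
  assumes \<mu>: "\<mu> = p # q # r # replicate m 1" "is_partition \<mu>"
    and xs: "xs = u # v # w # replicate m 1" and sums: "u + v + w = p + q + r"
  shows "gt_patterns \<mu> xs = three_row_pattern \<mu> u `
    {(a, b). a + b = u + v \<and> b \<le> u \<and> u \<le> a \<and> q \<le> a \<and> a \<le> p \<and> r \<le> b \<and> b \<le> q}"
    (is "_ = _ ` ?S")
proof (intro equalityI subsetI)
  fix g assume g: "g \<in> gt_patterns \<mu> xs"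
  have len: "length \<mu> = Suc (Suc (Suc m))" using \<mu>(1) by simp
  have sum3: "(\<Sum>i<length \<mu>. f i) = f 0 + f 1 + f 2 + (\<Sum>i<m. f (Suc (Suc (Suc i))))" for f :: "nat \<Rightarrow> nat"
    unfolding len sum.lessThan_Suc_shift by (simp add: numeral_2_eq_2)
  have z: "g k i = 0" if "k \<le> i" for k i
    using gt_patterns_eq_0[OF g that] .
  have high: "g k = full_pattern \<mu> k" if "k \<ge> 3" for k
  proof -
    have "k = Suc (Suc (Suc (k - 3)))" using that by simp
    then obtain d where "k = Suc (Suc (Suc d))" ..
    then show ?thesis
      using sums by (intro gt_patterns_full_level[OF g]) (simp add: \<mu>(1) xs)
  qed
  have g1: "g 1 0 = u"
    using gt_patterns_sum[OF g, of 1] unfolding sum3 by (simp add: z xs)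
  have g2: "g 2 0 + g 2 1 = u + v"
    using gt_patterns_sum[OF g, of 2] unfolding sum3 by (simp add: z xs numeral_2_eq_2)
  have g3: "g 3 0 = p" "g 3 1 = q" "g 3 2 = r"
    by (simp_all add: high full_pattern_def row_def \<mu>(1) len numeral_2_eq_2)
  have n23: "Suc 1 = 2" "Suc 2 = 3" by simp_all
  have "(g 2 0, g 2 1) \<in> ?S"
    using g1 g2 g3 gt_patterns_interlace[OF g, of 1 0] gt_patterns_interlace[OF g, of 2 0]
      gt_patterns_interlace[OF g, of 2 1] unfolding n23 One_nat_def[symmetric] by simp
  moreover have "g = three_row_pattern \<mu> u (g 2 0, g 2 1)"
  proof (intro ext)
    fix k i :: nat
    consider "k = 0" | "k = 1" | "k = 2" | "k \<ge> 3" by linarith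
    then show "g k i = three_row_pattern \<mu> u (g 2 0, g 2 1) k i"
    proof cases
      case 1
      then show ?thesis by (simp add: three_row_pattern_def z full_pattern_def)
    next
      case 2
      then show ?thesis using g1 by (simp add: three_row_pattern_def z)
    next
      case 3
      then show ?thesis
        using z[of 2 i] by (cases "i = 0 \<or> i = 1") (auto simp: three_row_pattern_def)
    next
      case 4
      then show ?thesis by (simp add: three_row_pattern_def high)
    qed
  qed
  ultimately show "g \<in> three_row_pattern \<mu> u ` ?S" by (rule rev_image_eqI)
next
  fix g assume "g \<in> three_row_pattern \<mu> u ` ?S"
  then obtain a b where ab: "a + b = u + v" "b \<le> u" "u \<le> a" "q \<le> a" "a \<le> p" "r \<le> b" "b \<le> q"
    and g: "g = three_row_pattern \<mu> u (a, b)" by auto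
  have len: "length \<mu> = Suc (Suc (Suc m))" using \<mu>(1) by simp
  have sum3: "(\<Sum>i<length \<mu>. f i) = f 0 + f 1 + f 2 + (\<Sum>i<m. f (Suc (Suc (Suc i))))" for f :: "nat \<Rightarrow> nat"
    unfolding len sum.lessThan_Suc_shift by (simp add: numeral_2_eq_2)
  note full = full_pattern_in_gt_patterns[OF \<mu>(2)]
  have high: "g k = full_pattern \<mu> k" if "k = 0 \<or> k \<ge> 3" for k
    using that by (auto simp: g three_row_pattern_def)
  have low: "g 1 = (\<lambda>i. if i = 0 then u else 0)" "g 2 = (\<lambda>i. if i = 0 then a else if i = 1 then b else 0)"
    by (simp_all add: g three_row_pattern_def)
  have g3: "g 3 i = (if i = 0 then p else if i = 1 then q else if i = 2 then r else 0)" for i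
    by (auto simp: high full_pattern_def row_def \<mu>(1) len numeral_2_eq_2 numeral_3_eq_3 nth_Cons split: nat.split)
  have "g 0 = (\<lambda>_. 0)"
    by (auto simp: high full_pattern_def)
  moreover have "g k = row \<mu>" if "k \<ge> length xs" for k
    using that full \<mu>(1) xs by (simp add: high gt_patterns_def)
  moreover have "g (Suc k) (Suc i) \<le> g k i \<and> g k i \<le> g (Suc k) i" for k i
  proof -
    consider "k = 0" | "k = 1" | "k = 2" | "k \<ge> 3" by linarith
    then show ?thesis
    proof cases
      case 1
      then show ?thesis using low by (simp add: high full_pattern_def)
    next
      case 2
      then show ?thesis using low ab by (auto simp: numeral_2_eq_2)
    next
      case 3
      have "Suc k = 3" using 3 by simp
      then show ?thesis using low ab g3 3 by auto
    next
      case 4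
      then show ?thesis
        using gt_patterns_interlace[OF full, of k i] by (simp add: high)
    qed
  qed
  moreover have "(\<Sum>i<length \<mu>. g (Suc k) i) = (\<Sum>i<length \<mu>. g k i) + xs ! k" if "k < length xs" for k
  proof -
    consider "k = 0" | "k = 1" | "k = 2" | "k \<ge> 3" by linarith
    then show ?thesis
    proof cases
      case 1
      then show ?thesis using low by (simp add: sum3 high full_pattern_def xs)
    next
      case 2
      have "g (Suc k) = g 2" using 2 by (simp add: numeral_2_eq_2)
      then show ?thesis using low ab 2 by (simp add: sum3 xs)
    next
      case 3
      have "g (Suc k) = g 3" using 3 by (simp add: numeral_3_eq_3 numeral_2_eq_2)
      then show ?thesis using low ab g3 3 sums by (simp add: sum3 xs)
    next
      case 4
      then have "k = Suc (Suc (Suc (k - 3)))" by simp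
      then obtain d where d: "k = Suc (Suc (Suc d))" ..
      have "\<mu> ! k = xs ! k" using d that by (simp add: \<mu>(1) xs)
      then show ?thesis
        using 4 that gt_patterns_sum_Suc[OF full, of k] by (simp add: high \<mu>(1) xs)
    qed
  qed
  ultimately show "g \<in> gt_patterns \<mu> xs"
    unfolding gt_patterns_def by blast
qed

lemma inj_three_row_pattern: "inj (three_row_pattern \<mu> u)"
proof (rule injI, clarify)
  fix a b a' b' assume eq: "three_row_pattern \<mu> u (a, b) = three_row_pattern \<mu> u (a', b')"
  have "three_row_pattern \<mu> u (c, d) 2 0 = c \<and> three_row_pattern \<mu> u (c, d) 2 1 = d" for c d
    by (simp add: three_row_pattern_def)
  then show "a = a' \<and> b = b'" using eq by metis
qed

lemma card_gt_patterns_three_rows: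
  assumes "is_partition (p # q # r # replicate m 1)" "u + v + w = p + q + r"
  shows "card (gt_patterns (p # q # r # replicate m 1) (u # v # w # replicate m 1)) =
    card {(a, b). a + b = u + v \<and> b \<le> u \<and> u \<le> a \<and> q \<le> a \<and> a \<le> p \<and> r \<le> b \<and> b \<le> q}"
  unfolding gt_patterns_three_rows[OF refl assms(1) refl assms(2)]
  by (rule card_image) (rule inj_on_subset[OF inj_three_row_pattern subset_UNIV])

lemma sorted_wrt_ge_replicate: "sorted_wrt (\<ge>) (replicate m (x :: nat))"
  by (simp add: sorted_wrt_iff_nth_less)

text \<open>
  The three Kostka numbers of the triangular system. Removing the full first column turns them into
  the Kostka numbers of (3,3) and (3,2,1) with contents (3,2,1) and (2,2,2).
\<close>

lemma kostka_441_432: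
  "card (gt_patterns (4 # 4 # 1 # replicate m 1) (4 # 3 # 2 # replicate m 1)) = 1"
proof -
  have "{(a, b). a + b = 4 + 3 \<and> b \<le> 4 \<and> 4 \<le> a \<and> 4 \<le> a \<and> a \<le> 4 \<and> 1 \<le> b \<and> b \<le> (4::nat)} = {(4, 3)}"
    by auto
  then show ?thesis
    by (subst card_gt_patterns_three_rows) (auto simp: is_partition_def sorted_wrt_ge_replicate)
qed

lemma kostka_441_333:
  "card (gt_patterns (4 # 4 # 1 # replicate m 1) (3 # 3 # 3 # replicate m 1)) = 1"
proof -
  have "{(a, b). a + b = 3 + 3 \<and> b \<le> 3 \<and> 3 \<le> a \<and> 4 \<le> a \<and> a \<le> 4 \<and> 1 \<le> b \<and> b \<le> (4::nat)} = {(4, 2)}"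
    by auto
  then show ?thesis
    by (subst card_gt_patterns_three_rows) (auto simp: is_partition_def sorted_wrt_ge_replicate)
qed

lemma kostka_432_333:
  "card (gt_patterns (4 # 3 # 2 # replicate m 1) (3 # 3 # 3 # replicate m 1)) = 2"
proof -
  have "{(a, b). a + b = 3 + 3 \<and> b \<le> 3 \<and> 3 \<le> a \<and> 3 \<le> a \<and> a \<le> 4 \<and> 2 \<le> b \<and> b \<le> (3::nat)} = {(3, 3), (4, 2)}"
    by auto
  then show ?thesis
    by (subst card_gt_patterns_three_rows) (auto simp: is_partition_def sorted_wrt_ge_replicate)
qed

section \<open>Colorings with prescribed color class sizes\<close>

definition stable_set :: "('a \<times> 'a) set \<Rightarrow> 'a set \<Rightarrow> bool" where
  "stable_set E B \<longleftrightarrow> (\<forall>u\<in>B. \<forall>v\<in>B. (u, v) \<notin> E)"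

text \<open>
  The number of lists of disjoint stable sets of the sizes \<open>xs\<close> that exhaust \<open>V\<close>.
  Since it peels off one color class at a time, it is the form in which all coefficients of
  chromatic symmetric functions are computed below.
\<close>

fun stable_count :: "('a \<times> 'a) set \<Rightarrow> 'a set \<Rightarrow> nat list \<Rightarrow> nat" where
  "stable_count E V [] = of_bool (V = {})"
| "stable_count E V (s # xs) = (\<Sum>B | B \<subseteq> V \<and> stable_set E B \<and> card B = s. stable_count E (V - B) xs)"

text \<open>
  The colors start at \<open>k\<close> so that removing the first color class leaves a coloring of the same
  kind without renaming any color.
\<close>

definition colorings_of_type :: "('a \<times> 'a) set \<Rightarrow> 'a set \<Rightarrow> nat \<Rightarrow> nat list \<Rightarrow> ('a \<Rightarrow> nat) set" where
  "colorings_of_type E V k xs = {\<kappa> \<in> V \<rightarrow>\<^sub>E {k..<k + length xs}.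
     (\<forall>u\<in>V. \<forall>v\<in>V. (u, v) \<in> E \<longrightarrow> \<kappa> u \<noteq> \<kappa> v) \<and>
     (\<forall>i<length xs. card {v \<in> V. \<kappa> v = k + i} = xs ! i)}"

lemma finite_colorings_of_type: "finite V \<Longrightarrow> finite (colorings_of_type E V k xs)"
  unfolding colorings_of_type_def by (rule finite_subset[OF _ finite_PiE[of V "\<lambda>_. {k..<k + length xs}"]]) auto

lemma card_colorings_first_class:
  assumes B: "B \<subseteq> V" "stable_set E B" "card B = s"
  shows "card {\<kappa> \<in> colorings_of_type E V k (s # xs). {v \<in> V. \<kappa> v = k} = B} =
    card (colorings_of_type E (V - B) (Suc k) xs)"
proof (rule bij_betw_same_card)
  let ?L = "{\<kappa> \<in> colorings_of_type E V k (s # xs). {v \<in> V. \<kappa> v = k} = B}"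
  let ?R = "colorings_of_type E (V - B) (Suc k) xs"
  let ?ext = "\<lambda>\<kappa>. \<lambda>v\<in>V. if v \<in> B then k else \<kappa> v"
  show "bij_betw (\<lambda>\<kappa>. restrict \<kappa> (V - B)) ?L ?R"
  proof (rule bij_betw_byWitness[where f' = ?ext])
    show "\<forall>\<kappa>\<in>?L. ?ext (restrict \<kappa> (V - B)) = \<kappa>"
    proof
      fix \<kappa> assume \<kappa>: "\<kappa> \<in> ?L"
      then have "\<kappa> \<in> extensional V" and "{v \<in> V. \<kappa> v = k} = B"
        by (auto simp: colorings_of_type_def PiE_def)
      then show "?ext (restrict \<kappa> (V - B)) = \<kappa>"
        by (intro ext) (auto simp: restrict_def extensional_def)
    qed
    show "\<forall>\<kappa>\<in>?R. restrict (?ext \<kappa>) (V - B) = \<kappa>"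
    proof
      fix \<kappa> assume "\<kappa> \<in> ?R"
      then have "\<kappa> \<in> extensional (V - B)"
        by (auto simp: colorings_of_type_def PiE_def)
      then show "restrict (?ext \<kappa>) (V - B) = \<kappa>"
        by (intro ext) (auto simp: restrict_def extensional_def)
    qed
    show "(\<lambda>\<kappa>. restrict \<kappa> (V - B)) ` ?L \<subseteq> ?R"
    proof
      fix \<rho> assume "\<rho> \<in> (\<lambda>\<kappa>. restrict \<kappa> (V - B)) ` ?L"
      then obtain \<kappa> where \<rho>: "\<rho> = restrict \<kappa> (V - B)" and \<kappa>: "\<kappa> \<in> colorings_of_type E V k (s # xs)"
        and first: "{v \<in> V. \<kappa> v = k} = B" by blast
      have range: "\<kappa> v \<in> {k..<k + length (s # xs)}" if "v \<in> V" for v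
        using \<kappa> that unfolding colorings_of_type_def by (auto dest: PiE_mem)
      have "\<rho> \<in> (V - B) \<rightarrow>\<^sub>E {Suc k..<Suc k + length xs}"
      proof (rule PiE_I)
        fix v assume v: "v \<in> V - B"
        then have "\<kappa> v \<noteq> k" using first by blast
        then show "\<rho> v \<in> {Suc k..<Suc k + length xs}"
          using range[of v] v by (simp add: \<rho>)
      qed (auto simp: \<rho>)
      moreover have "card {v \<in> V - B. \<rho> v = Suc k + i} = xs ! i" if "i < length xs" for i
      proof -
        have "{v \<in> V - B. \<rho> v = Suc k + i} = {v \<in> V. \<kappa> v = k + Suc i}"
          using first by (auto simp: \<rho>)
        moreover have "card {v \<in> V. \<kappa> v = k + Suc i} = (s # xs) ! Suc i"
          using \<kappa> that unfolding colorings_of_type_def by fastforce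
        ultimately show ?thesis by simp
      qed
      moreover have "\<forall>u\<in>V - B. \<forall>v\<in>V - B. (u, v) \<in> E \<longrightarrow> \<rho> u \<noteq> \<rho> v"
        using \<kappa> by (simp add: \<rho> colorings_of_type_def)
      ultimately show "\<rho> \<in> ?R" unfolding colorings_of_type_def by blast
    qed
    show "?ext ` ?R \<subseteq> ?L"
    proof
      fix \<kappa> assume "\<kappa> \<in> ?ext ` ?R"
      then obtain \<rho> where \<kappa>: "\<kappa> = ?ext \<rho>" and \<rho>: "\<rho> \<in> ?R" by blast
      have range: "\<rho> v \<in> {Suc k..<Suc k + length xs}" if "v \<in> V - B" for v
        using \<rho> that unfolding colorings_of_type_def by (auto dest: PiE_mem)
      have first: "{v \<in> V. \<kappa> v = k} = B"
        using B range by (fastforce simp: \<kappa> split: if_splits)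
      have "\<kappa> \<in> V \<rightarrow>\<^sub>E {k..<k + length (s # xs)}"
      proof (rule PiE_I)
        fix v assume v: "v \<in> V"
        then show "\<kappa> v \<in> {k..<k + length (s # xs)}"
          using range[of v] by (auto simp: \<kappa>)
      qed (auto simp: \<kappa>)
      moreover have "card {v \<in> V. \<kappa> v = k + i} = (s # xs) ! i" if "i < length (s # xs)" for i
      proof (cases i)
        case 0
        then show ?thesis using first B(3) by simp
      next
        case (Suc j)
        have "{v \<in> V. \<kappa> v = k + Suc j} = {v \<in> V - B. \<rho> v = Suc k + j}"
          by (auto simp: \<kappa>)
        moreover have "card {v \<in> V - B. \<rho> v = Suc k + j} = xs ! j"
          using \<rho> that Suc unfolding colorings_of_type_def by fastforce
        ultimately show ?thesis using Suc by simp
      qed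
      moreover have "\<kappa> u \<noteq> \<kappa> v" if uv: "u \<in> V" "v \<in> V" "(u, v) \<in> E" for u v
      proof -
        consider "u \<in> B" "v \<in> B" | "u \<in> B" "v \<notin> B" | "u \<notin> B" "v \<in> B" | "u \<notin> B" "v \<notin> B" by blast
        then show ?thesis
        proof cases
          case 1
          then show ?thesis using B(2) uv by (simp add: stable_set_def)
        next
          case 2
          then show ?thesis using range[of v] uv by (auto simp: \<kappa>)
        next
          case 3
          then show ?thesis using range[of u] uv by (auto simp: \<kappa>)
        next
          case 4
          then show ?thesis using \<rho> uv by (simp add: \<kappa> colorings_of_type_def)
        qed
      qed
      ultimately show "\<kappa> \<in> ?L"
        using first unfolding colorings_of_type_def by blast
    qed
  qed
qed

lemma card_colorings_of_type:
  assumes "finite V"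
  shows "card (colorings_of_type E V k xs) = stable_count E V xs"
  using assms
proof (induction xs arbitrary: V k)
  case Nil
  show ?case
  proof (cases "V = {}")
    case True
    then have "colorings_of_type E V k [] = {\<lambda>_. undefined}"
      by (auto simp: colorings_of_type_def)
    then show ?thesis using True by simp
  next
    case False
    then have "colorings_of_type E V k [] = {}"
      by (auto simp: colorings_of_type_def PiE_eq_empty_iff)
    then show ?thesis using False by simp
  qed
next
  case (Cons s xs)
  let ?B = "{B. B \<subseteq> V \<and> stable_set E B \<and> card B = s}"
  let ?fib = "\<lambda>B. {\<kappa> \<in> colorings_of_type E V k (s # xs). {v \<in> V. \<kappa> v = k} = B}"
  have "{v \<in> V. \<kappa> v = k} \<in> ?B" if \<kappa>: "\<kappa> \<in> colorings_of_type E V k (s # xs)" for \<kappa>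
  proof -
    have "card {v \<in> V. \<kappa> v = k + 0} = (s # xs) ! 0"
      using \<kappa> unfolding colorings_of_type_def by blast
    moreover have "stable_set E {v \<in> V. \<kappa> v = k}"
      using \<kappa> unfolding colorings_of_type_def stable_set_def by fastforce
    ultimately show ?thesis by simp
  qed
  then have union: "colorings_of_type E V k (s # xs) = (\<Union>B\<in>?B. ?fib B)" by auto
  have "card (\<Union>B\<in>?B. ?fib B) = (\<Sum>B\<in>?B. card (?fib B))"
  proof (rule card_UN_disjoint)
    show "\<forall>B\<in>?B. finite (?fib B)"
      using finite_colorings_of_type[OF Cons.prems, of E k "s # xs"] by (auto intro: finite_subset)
  qed (use Cons.prems in auto)
  then have "card (colorings_of_type E V k (s # xs)) = (\<Sum>B\<in>?B. card (?fib B))"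
    by (simp only: union[symmetric])
  also have "\<dots> = (\<Sum>B\<in>?B. stable_count E (V - B) xs)"
    using Cons by (intro sum.cong) (auto simp: card_colorings_first_class)
  finally show ?case by simp
qed

lemma chromatic_sym_expo:
  assumes "pair_graph G"
  shows "chromatic_sym G (expo xs) = int (stable_count (parcs G) (pverts G) xs)"
proof -
  interpret pair_graph G by fact
  let ?V = "pverts G" and ?E = "parcs G"
  have "{\<kappa> \<in> proper_colorings G. (\<Sum>v\<in>?V. var (\<kappa> v)) = expo xs} = colorings_of_type ?E ?V 1 xs"
  proof (intro equalityI subsetI)
    fix \<kappa> assume "\<kappa> \<in> {\<kappa> \<in> proper_colorings G. (\<Sum>v\<in>?V. var (\<kappa> v)) = expo xs}"
    then have \<kappa>: "\<kappa> \<in> ?V \<rightarrow>\<^sub>E {1..}" "\<forall>(u, v)\<in>?E. \<kappa> u \<noteq> \<kappa> v"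
      and content: "(\<Sum>v\<in>?V. var (\<kappa> v)) = expo xs" by (auto simp: proper_colorings_def)
    have count: "card {v \<in> ?V. \<kappa> v = i} = Poly_Mapping.lookup (expo xs) i" for i
      by (simp add: content[symmetric] lookup_sum_var)
    have "\<kappa> v \<in> {1..<1 + length xs}" if v: "v \<in> ?V" for v
    proof -
      have "{v' \<in> ?V. \<kappa> v' = \<kappa> v} \<noteq> {}" using v by blast
      then have "card {v' \<in> ?V. \<kappa> v' = \<kappa> v} \<noteq> 0" by (simp add: card_eq_0_iff)
      then show ?thesis unfolding count by (auto simp: lookup_expo split: if_splits)
    qed
    then have "\<kappa> \<in> ?V \<rightarrow>\<^sub>E {1..<1 + length xs}"
      using \<kappa>(1) by (auto simp: PiE_def)
    then show "\<kappa> \<in> colorings_of_type ?E ?V 1 xs"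
      using \<kappa>(2) unfolding colorings_of_type_def by (auto simp: count lookup_expo)
  next
    fix \<kappa> assume "\<kappa> \<in> colorings_of_type ?E ?V 1 xs"
    then have \<kappa>: "\<kappa> \<in> ?V \<rightarrow>\<^sub>E {1..<1 + length xs}" "\<forall>u\<in>?V. \<forall>v\<in>?V. (u, v) \<in> ?E \<longrightarrow> \<kappa> u \<noteq> \<kappa> v"
      "\<forall>i<length xs. card {v \<in> ?V. \<kappa> v = 1 + i} = xs ! i"
      by (auto simp: colorings_of_type_def)
    have "card {v \<in> ?V. \<kappa> v = i} = Poly_Mapping.lookup (expo xs) i" for i
    proof (cases "1 \<le> i \<and> i < 1 + length xs")
      case True
      then have "i - 1 < length xs" by auto
      then show ?thesis using True \<kappa>(3)[rule_format, of "i - 1"] by (simp add: lookup_expo)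
    next
      case False
      then have "{v \<in> ?V. \<kappa> v = i} = {}" using \<kappa>(1) by (auto dest: PiE_mem)
      then have "card {v \<in> ?V. \<kappa> v = i} = 0" by (simp only: card.empty)
      then show ?thesis using False by (auto simp: lookup_expo)
    qed
    then have "(\<Sum>v\<in>?V. var (\<kappa> v)) = expo xs"
      by (intro poly_mapping_eqI) (simp add: lookup_sum_var)
    moreover have "\<kappa> u \<noteq> \<kappa> v" if "(u, v) \<in> ?E" for u v
      using \<kappa>(2) that wellformed'[OF that] by simp
    moreover have "\<kappa> \<in> ?V \<rightarrow>\<^sub>E {1..}"
      using \<kappa>(1) by (auto simp: PiE_def Pi_def)
    ultimately show "\<kappa> \<in> {\<kappa> \<in> proper_colorings G. (\<Sum>v\<in>?V. var (\<kappa> v)) = expo xs}"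
      unfolding proper_colorings_def by blast
  qed
  then show ?thesis
    unfolding chromatic_sym_def by (simp add: card_colorings_of_type)
qed

text \<open>
  After the first \<open>us\<close> classes are removed, choosing \<open>B\<close> before \<open>C\<close> or
  \<open>C\<close> before \<open>B\<close> leaves the same vertices.
\<close>

lemma stable_count_swap:
  assumes "finite V"
  shows "stable_count E V (us @ x # y # vs) = stable_count E V (us @ y # x # vs)"
  using assms
proof (induction us arbitrary: V)
  case Nil
  let ?S = "\<lambda>V s. {B. B \<subseteq> V \<and> stable_set E B \<and> card B = s}"
  have fin: "finite (?S W s)" if "W \<subseteq> V" for W s
    by (rule finite_subset[of _ "Pow V"]) (use that Nil in auto)
  have expand: "stable_count E V (x # y # vs) =
      (\<Sum>(B, C) \<in> Sigma (?S V x) (\<lambda>B. ?S (V - B) y). stable_count E (V - B - C) vs)" for x y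
    using fin by (simp add: sum.Sigma)
  have "stable_count E V (x # y # vs) = stable_count E V (y # x # vs)"
    unfolding expand
    by (rule sum.reindex_bij_witness[of _ prod.swap prod.swap])
      (auto simp: Diff_eq Int_ac)
  then show ?case by simp
qed auto

lemma stable_count_sum_list:
  "finite V \<Longrightarrow> stable_count E V xs \<noteq> 0 \<Longrightarrow> sum_list xs = card V"
proof (induction xs arbitrary: V)
  case (Cons s xs)
  from Cons.prems(2) obtain B where "B \<in> {B. B \<subseteq> V \<and> stable_set E B \<and> card B = s}"
    "stable_count E (V - B) xs \<noteq> 0"
    unfolding stable_count.simps by (rule sum.not_neutral_contains_not_neutral)
  then have B: "B \<subseteq> V" "card B = s" "stable_count E (V - B) xs \<noteq> 0" by auto
  then have "sum_list xs = card (V - B)" using Cons by simp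
  then show ?case
    using B Cons.prems(1) card_mono[OF Cons.prems(1) B(1)] by (simp add: card_Diff_subset finite_subset)
qed (auto split: if_splits)

text \<open>
  Each color class takes at most one vertex out of the clique \<open>K\<close>, so \<open>K\<close> cannot be
  exhausted by fewer classes than it has vertices.
\<close>

lemma stable_count_clique:
  assumes "finite V" "K \<subseteq> V" "\<And>u v. u \<in> K \<Longrightarrow> v \<in> K \<Longrightarrow> u \<noteq> v \<Longrightarrow> (u, v) \<in> E" "length xs < card K"
  shows "stable_count E V xs = 0"
  using assms
proof (induction xs arbitrary: V K)
  case (Cons s xs)
  have "stable_count E (V - B) xs = 0" if B: "B \<subseteq> V" "stable_set E B" for B
  proof (rule Cons.IH[of _ "K - B"])
    have "card (B \<inter> K) \<le> Suc 0"
    proof (rule card_le_Suc0_iff_eq[THEN iffD2])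
      show "finite (B \<inter> K)" using Cons.prems(1) B(1) by (auto intro: finite_subset)
      show "\<forall>u\<in>B \<inter> K. \<forall>v\<in>B \<inter> K. u = v"
        using Cons.prems(3) B(2) unfolding stable_set_def by blast
    qed
    moreover have "card K = card (K - B) + card (B \<inter> K)"
      using card_Int_Diff[of K B] Cons.prems(1,2) finite_subset by (metis add.commute inf_commute)
    ultimately show "length xs < card (K - B)" using Cons.prems(4) by simp
  qed (use Cons.prems in auto)
  then show ?case by simp
qed auto

lemma stable_count_ones:
  assumes "finite V" "\<And>v. (v, v) \<notin> E" "card V = k"
  shows "stable_count E V (replicate k 1) = fact k"
  using assms(1,3)
proof (induction k arbitrary: V)
  case (Suc k)
  have "{B. B \<subseteq> V \<and> stable_set E B \<and> card B = 1} = (\<lambda>v. {v}) ` V"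
    using assms(2) by (auto simp: stable_set_def card_1_singleton_iff)
  then have "stable_count E V (replicate (Suc k) 1) = (\<Sum>v\<in>V. stable_count E (V - {v}) (replicate k 1))"
    by (simp add: sum.reindex)
  also have "\<dots> = (\<Sum>v\<in>V. fact k)"
    using Suc by (intro sum.cong) auto
  finally show ?case using Suc.prems by simp
qed auto

lemma symmetric_series_chromatic_sym:
  assumes "pair_graph G"
  shows "symmetric_series (chromatic_sym G)"
proof -
  interpret pair_graph G by fact
  have "chromatic_sym G \<alpha> = 0" if "\<not> Poly_Mapping.keys \<alpha> \<subseteq> {1..}" for \<alpha>
  proof -
    from that have 0: "Poly_Mapping.lookup \<alpha> 0 \<noteq> 0"
      by (metis atLeast_iff in_keys_iff less_one not_le subsetI)
    have "(\<Sum>v\<in>pverts G. var (\<kappa> v)) \<noteq> \<alpha>" if \<kappa>: "\<kappa> \<in> proper_colorings G" for \<kappa>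
    proof
      assume "(\<Sum>v\<in>pverts G. var (\<kappa> v)) = \<alpha>"
      then have "card {v \<in> pverts G. \<kappa> v = 0} \<noteq> 0"
        using 0 lookup_sum_var[OF finite_verts, of \<kappa> 0] by argo
      moreover have "\<kappa> v \<ge> 1" if "v \<in> pverts G" for v
        using \<kappa> that PiE_mem[of \<kappa> "pverts G" "\<lambda>_. {1..}" v] by (simp add: proper_colorings_def)
      then have "{v \<in> pverts G. \<kappa> v = 0} = {}" by fastforce
      ultimately show False by (simp only: card.empty)
    qed
    then have "{\<kappa> \<in> proper_colorings G. (\<Sum>v\<in>pverts G. var (\<kappa> v)) = \<alpha>} = {}" by blast
    then show ?thesis unfolding chromatic_sym_def by (simp only: card.empty of_nat_0)
  qed
  then show ?thesis
    unfolding symmetric_series_def chromatic_sym_expo[OF assms]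
    using stable_count_swap[OF finite_verts] by simp
qed

lemma homogeneous_series_chromatic_sym:
  assumes "pair_graph G"
  shows "homogeneous_series (card (pverts G)) (chromatic_sym G)"
proof -
  interpret pair_graph G by fact
  show ?thesis
    unfolding homogeneous_series_def chromatic_sym_expo[OF assms]
    using stable_count_sum_list[of "pverts G"] by simp
qed

section \<open>Stable sets in $F_t$\<close>

definition K33_vertices :: "vertex list" where
  "K33_vertices = [Left 1, Left 2, Left 3, Right 1, Right 2, Right 3]"

fun K33_minus_edge_adj :: "vertex \<Rightarrow> vertex \<Rightarrow> bool" where
  "K33_minus_edge_adj (Left i) (Right j) \<longleftrightarrow> \<not> (i = 1 \<and> j = 1)"
| "K33_minus_edge_adj (Right i) (Left j) \<longleftrightarrow> \<not> (i = 1 \<and> j = 1)"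
| "K33_minus_edge_adj _ _ \<longleftrightarrow> False"

text \<open>
  The two vertices of the deleted edge make up the only stable set that meets both sides.
\<close>

definition K33_stable_sets :: "vertex list list" where
  "K33_stable_sets =
    [[], [Left 1], [Left 2], [Left 3], [Right 1], [Right 2], [Right 3],
     [Left 1, Left 2], [Left 1, Left 3], [Left 2, Left 3],
     [Right 1, Right 2], [Right 1, Right 3], [Right 2, Right 3], [Left 1, Right 1],
     [Left 1, Left 2, Left 3], [Right 1, Right 2, Right 3]]"

lemma K33_stable_sets_perm:
  "mset K33_stable_sets = mset (filter (\<lambda>B. \<forall>u\<in>set B. \<forall>v\<in>set B. \<not> K33_minus_edge_adj u v) (subseqs K33_vertices))"
  by code_simp

lemma set_K33_vertices: "set K33_vertices = Left ` {1..3} \<union> Right ` {1..3}"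
proof -
  have "{1..3} = {1, 2, 3 :: nat}" by auto
  then show ?thesis by (auto simp: K33_vertices_def)
qed

lemma distinct_K33_vertices: "distinct K33_vertices"
  by (simp add: K33_vertices_def)

lemma set_K33_stable_sets:
  "set K33_stable_sets = {B \<in> set (subseqs K33_vertices). \<forall>u\<in>set B. \<forall>v\<in>set B. \<not> K33_minus_edge_adj u v}"
  using arg_cong[OF K33_stable_sets_perm, of set_mset] by simp

lemma length_K33_stable_set: "B \<in> set K33_stable_sets \<Longrightarrow> length B = card (set B)"
  using subseqs_distinctD[OF _ distinct_K33_vertices]
  by (auto simp: set_K33_stable_sets distinct_card)

lemma distinct_K33_stable_sets: "distinct (map set K33_stable_sets)"
proof -
  have "distinct (map set (filter (\<lambda>B. \<forall>u\<in>set B. \<forall>v\<in>set B. \<not> K33_minus_edge_adj u v) (subseqs K33_vertices)))"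
    by (intro distinct_map_filter distinct_set_subseqs distinct_K33_vertices)
  moreover have "mset (map set K33_stable_sets) =
      mset (map set (filter (\<lambda>B. \<forall>u\<in>set B. \<forall>v\<in>set B. \<not> K33_minus_edge_adj u v) (subseqs K33_vertices)))"
    unfolding mset_map K33_stable_sets_perm ..
  then have "distinct (map set K33_stable_sets) \<longleftrightarrow>
      distinct (map set (filter (\<lambda>B. \<forall>u\<in>set B. \<forall>v\<in>set B. \<not> K33_minus_edge_adj u v) (subseqs K33_vertices)))"
    by (rule mset_eq_imp_distinct_iff)
  ultimately show ?thesis by (rule iffD2[rotated])
qed

lemma pverts_F_graph: "pverts (F_graph t) = set K33_vertices \<union> Clique ` {1..t}"
  by (simp add: F_graph_def K33_minus_edge_def K33_def clique_def Let_def set_K33_vertices)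

lemma parcs_F_graph_K33:
  assumes "u \<in> set K33_vertices" "v \<in> set K33_vertices"
  shows "(u, v) \<in> parcs (F_graph t) \<longleftrightarrow> K33_minus_edge_adj u v"
  using assms unfolding set_K33_vertices
  by (auto simp: F_graph_def K33_minus_edge_def K33_def clique_def Let_def)

lemma parcs_F_graph_clique:
  "(Clique i, Clique j) \<in> parcs (F_graph t) \<longleftrightarrow> i \<in> {1..t} \<and> j \<in> {1..t} \<and> i \<noteq> j"
  by (auto simp: F_graph_def K33_minus_edge_def K33_def clique_def Let_def)

lemma parcs_F_graph_mixed:
  assumes "u \<in> set K33_vertices"
  shows "(u, Clique j) \<in> parcs (F_graph t) \<longleftrightarrow> u = Left 1 \<and> j = 1"
    "(Clique j, u) \<in> parcs (F_graph t) \<longleftrightarrow> u = Left 1 \<and> j = 1"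
  using assms unfolding set_K33_vertices
  by (auto simp: F_graph_def K33_minus_edge_def K33_def clique_def Let_def)

lemma sum_K33_stable_sets:
  assumes "A \<subseteq> set K33_vertices"
  shows "(\<Sum>B | B \<subseteq> A \<and> stable_set (parcs (F_graph t)) B \<and> card B = s. h B) =
    (\<Sum>B\<leftarrow>filter (\<lambda>B. length B = s \<and> set B \<subseteq> A) K33_stable_sets. h (set B) :: nat)"
proof -
  let ?Bs = "filter (\<lambda>B. length B = s \<and> set B \<subseteq> A) K33_stable_sets"
  have stable: "stable_set (parcs (F_graph t)) B \<longleftrightarrow> (\<forall>u\<in>B. \<forall>v\<in>B. \<not> K33_minus_edge_adj u v)"
    if "B \<subseteq> set K33_vertices" for B
    using that unfolding stable_set_def by (meson parcs_F_graph_K33 subsetD)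
  have "{B. B \<subseteq> A \<and> stable_set (parcs (F_graph t)) B \<and> card B = s} = set ` set ?Bs"
  proof (intro equalityI subsetI)
    fix B assume B: "B \<in> {B. B \<subseteq> A \<and> stable_set (parcs (F_graph t)) B \<and> card B = s}"
    then have "B \<in> Pow (set K33_vertices)" using assms by auto
    then have "B \<in> set ` set (subseqs K33_vertices)" by (simp only: subseqs_powset)
    then obtain C where C: "C \<in> set (subseqs K33_vertices)" "B = set C" by blast
    then have "C \<in> set K33_stable_sets"
      using B stable[of B] assms by (auto simp: set_K33_stable_sets)
    then show "B \<in> set ` set ?Bs"
      using B C(2) length_K33_stable_set[of C] by auto
  next
    fix B assume "B \<in> set ` set ?Bs"
    then obtain C where C: "C \<in> set K33_stable_sets" "B = set C" "length C = s" "set C \<subseteq> A" by auto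
    then show "B \<in> {B. B \<subseteq> A \<and> stable_set (parcs (F_graph t)) B \<and> card B = s}"
      using stable[of B] assms length_K33_stable_set[of C] by (auto simp: set_K33_stable_sets)
  qed
  moreover have "distinct (map set ?Bs)"
    by (intro distinct_map_filter distinct_K33_stable_sets)
  ultimately show ?thesis
    by (simp only: distinct_map sum.reindex sum_list_distinct_conv_sum_set comp_def)
qed

text \<open>
  A stable set contains at most one clique vertex \<open>d\<close>, and the edge from \<open>Left 1\<close> to
  \<open>Clique 1\<close> is the only restriction on adding \<open>d\<close> to a stable set \<open>B\<close> of the
  other part.
\<close>

lemma sum_F_graph_stable_sets:
  assumes A: "A \<subseteq> set K33_vertices" and D: "D \<subseteq> Clique ` {1..t}"
  shows "(\<Sum>B | B \<subseteq> A \<union> D \<and> stable_set (parcs (F_graph t)) B \<and> card B = s. h B) =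
    (\<Sum>B | B \<subseteq> A \<and> stable_set (parcs (F_graph t)) B \<and> card B = s. h B) +
    (\<Sum>B | B \<subseteq> A \<and> stable_set (parcs (F_graph t)) B \<and> Suc (card B) = s.
       \<Sum>d\<in>D - (if Left 1 \<in> B then {Clique 1} else {}). h (insert d B) :: nat)"
proof -
  let ?E = "parcs (F_graph t)"
  let ?S0 = "{B. B \<subseteq> A \<and> stable_set ?E B \<and> card B = s}"
  let ?T = "{B. B \<subseteq> A \<and> stable_set ?E B \<and> Suc (card B) = s}"
  let ?D = "\<lambda>B. D - (if Left 1 \<in> B then {Clique 1} else {})"
  have fin: "finite A" "finite D"
    using A D by (auto intro: finite_subset)
  have disj: "Clique j \<notin> A" for j
    using A by (auto simp: set_K33_vertices)
  have "{B. B \<subseteq> A \<union> D \<and> stable_set ?E B \<and> card B = s} = ?S0 \<union> (\<lambda>(B, d). insert d B) ` Sigma ?T ?D"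
  proof (intro equalityI subsetI)
    fix B assume "B \<in> {B. B \<subseteq> A \<union> D \<and> stable_set ?E B \<and> card B = s}"
    then have B: "B \<subseteq> A \<union> D" "stable_set ?E B" "card B = s" by auto
    show "B \<in> ?S0 \<union> (\<lambda>(B, d). insert d B) ` Sigma ?T ?D"
    proof (cases "B \<subseteq> A")
      case True
      then show ?thesis using B by simp
    next
      case False
      then obtain d where d: "d \<in> B" "d \<in> D" "d \<notin> A" using B(1) by blast
      have unique: "v = d" if v: "v \<in> B" "v \<in> D" for v
      proof (rule ccontr)
        assume "v \<noteq> d"
        moreover obtain i j where "v = Clique i" "i \<in> {1..t}" "d = Clique j" "j \<in> {1..t}"
          using v(2) d(2) D by blast
        ultimately have "(v, d) \<in> ?E"
          by (simp add: parcs_F_graph_clique)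
        then show False using B(2) v d unfolding stable_set_def by blast
      qed
      have "Left 1 \<notin> B - {d} \<or> d \<noteq> Clique 1"
        using B(2) d parcs_F_graph_mixed(1)[of "Left 1" 1 t] unfolding stable_set_def
        by (auto simp: K33_vertices_def)
      moreover have "B - {d} \<subseteq> A" using B(1) unique by blast
      moreover have "stable_set ?E (B - {d})" using B(2) unfolding stable_set_def by blast
      moreover have "Suc (card (B - {d})) = s"
      proof -
        have "finite B" using B(1) fin by (auto intro: finite_subset)
        then show ?thesis using card.remove[of B d] d(1) B(3) by simp
      qed
      ultimately have "(B - {d}, d) \<in> Sigma ?T ?D" using d by auto
      moreover have "B = insert d (B - {d})" using d by blast
      ultimately show ?thesis by (intro UnI2) (rule image_eqI[of _ _ "(B - {d}, d)"], simp_all)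
    qed
  next
    fix B assume "B \<in> ?S0 \<union> (\<lambda>(B, d). insert d B) ` Sigma ?T ?D"
    then consider "B \<in> ?S0" | C d where "B = insert d C" "C \<in> ?T" "d \<in> ?D C" by auto
    then show "B \<in> {B. B \<subseteq> A \<union> D \<and> stable_set ?E B \<and> card B = s}"
    proof cases
      case 2
      then obtain j where d: "d = Clique j" using D by auto
      have "d \<notin> C" using 2 disj d by auto
      moreover have "finite C" using 2(2) fin by (auto intro: finite_subset)
      moreover have "stable_set ?E B"
        unfolding stable_set_def 2(1)
      proof (intro ballI)
        fix u v assume "u \<in> insert d C" "v \<in> insert d C"
        moreover have "(x, d) \<notin> ?E \<and> (d, x) \<notin> ?E" if "x \<in> C" for x
          using that 2 A parcs_F_graph_mixed[of x j t] by (auto simp: d)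
        moreover have "(d, d) \<notin> ?E" by (simp add: d parcs_F_graph_clique)
        ultimately show "(u, v) \<notin> ?E" using 2(2) by (auto simp: stable_set_def)
      qed
      ultimately show ?thesis using 2 by auto
    qed auto
  qed
  moreover have "?S0 \<inter> (\<lambda>(B, d). insert d B) ` Sigma ?T ?D = {}"
    using D disj by auto
  moreover have inj: "inj_on (\<lambda>(B, d). insert d B) (Sigma ?T ?D)"
  proof (rule inj_onI)
    fix z z' assume z: "z \<in> Sigma ?T ?D" "z' \<in> Sigma ?T ?D"
      "(\<lambda>(B, d). insert d B) z = (\<lambda>(B, d). insert d B) z'"
    obtain B d B' d' where zz: "z = (B, d)" "z' = (B', d')" by (cases z, cases z')
    have *: "B \<subseteq> A" "B' \<subseteq> A" "d \<in> ?D B" "d' \<in> ?D B'" "insert d B = insert d' B'"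
      using z unfolding zz by auto
    have "d \<notin> A" "d' \<notin> A" using *(3,4) D disj by auto
    then have notin: "d \<notin> B" "d' \<notin> B'" "d \<notin> B'" using *(1,2) by blast+
    have "d \<in> insert d' B'" using *(5) by blast
    then have "d = d'" using notin(3) by simp
    then show "z = z'" using *(5) notin by (simp add: zz insert_ident)
  qed
  moreover have fin0: "finite ?S0" "finite ?T"
    using fin by (auto intro: finite_subset[of _ "Pow A"])
  moreover have "finite (Sigma ?T ?D)" using fin0 fin by auto
  ultimately have "(\<Sum>B | B \<subseteq> A \<union> D \<and> stable_set ?E B \<and> card B = s. h B) =
      (\<Sum>B\<in>?S0. h B) + (\<Sum>(B, d)\<in>Sigma ?T ?D. h (insert d B))"
    by (simp add: sum.union_disjoint sum.reindex case_prod_beta')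
  also have "(\<Sum>(B, d)\<in>Sigma ?T ?D. h (insert d B)) = (\<Sum>B\<in>?T. \<Sum>d\<in>?D B. h (insert d B))"
    using fin0 fin by (subst sum.Sigma) auto
  finally show ?thesis .
qed

text \<open>
  All choices of disjoint stable sets inside \<open>A\<close>, where each prescribed size \<open>s\<close> is either
  that of the set itself or exceeds it by one, for a clique vertex to be added. A choice is recorded
  only by the number of sets that still need a clique vertex and by whether one of them contains
  \<open>Left 1\<close>, because the number of ways to add these vertices depends on nothing else.
\<close>

fun profiles :: "nat list \<Rightarrow> vertex list \<Rightarrow> (nat \<times> bool) list" where
  "profiles [] A = [(0, False)]"
| "profiles (s # xs) A =
    concat (map (\<lambda>B. profiles xs (filter (\<lambda>v. v \<notin> set B) A))
      (filter (\<lambda>B. length B = s \<and> set B \<subseteq> set A) K33_stable_sets)) @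
    concat (map (\<lambda>B. map (\<lambda>(q, f). (Suc q, f \<or> Left 1 \<in> set B)) (profiles xs (filter (\<lambda>v. v \<notin> set B) A)))
      (filter (\<lambda>B. Suc (length B) = s \<and> set B \<subseteq> set A) K33_stable_sets))"

lemma profiles_flag:
  "(q, f) \<in> set (profiles xs A) \<Longrightarrow> f \<Longrightarrow> 0 < q \<and> Left 1 \<in> set A"
proof (induction xs arbitrary: A q f)
  case (Cons s xs)
  from Cons.prems(1) consider
    B where "(q, f) \<in> set (profiles xs (filter (\<lambda>v. v \<notin> set B) A))"
    | B q' f' where "(q', f') \<in> set (profiles xs (filter (\<lambda>v. v \<notin> set B) A))" "q = Suc q'"
        "f \<longleftrightarrow> f' \<or> Left 1 \<in> set B" "set B \<subseteq> set A"
    by auto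
  then show ?case
  proof cases
    case 1
    then show ?thesis using Cons.IH Cons.prems(2) by fastforce
  next
    case 2
    show ?thesis
    proof (cases f')
      case True
      then show ?thesis using Cons.IH[OF 2(1)] 2(2) by simp
    next
      case False
      then show ?thesis using 2 Cons.prems(2) by auto
    qed
  qed
qed simp

fun falling_fact :: "nat \<Rightarrow> nat \<Rightarrow> nat" where
  "falling_fact n 0 = 1"
| "falling_fact n (Suc q) = n * falling_fact (n - 1) q"

text \<open>
  The number of ways to give \<open>q\<close> sets distinct clique vertices from \<open>D\<close>; the flag
  \<open>f\<close> says that one of the sets must not receive \<open>Clique 1\<close>. If \<open>f\<close> holds and
  \<open>Clique 1\<close> is available, that set chooses first, among the \<open>c\<close> other vertices.
\<close>

definition clique_weight :: "vertex set \<Rightarrow> nat \<times> bool \<Rightarrow> nat" where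
  "clique_weight D = (\<lambda>(q, f). let c = card (D - {Clique 1}) in
     if Clique 1 \<notin> D then falling_fact c q
     else if f then c * falling_fact c (q - 1) else falling_fact (Suc c) q)"

text \<open>
  Letting one set choose its clique vertex first does not change the number of assignments.
\<close>

lemma sum_clique_weight:
  assumes "finite D" "f \<Longrightarrow> 0 < q" "f \<Longrightarrow> \<not> g"
  shows "(\<Sum>d\<in>D - (if g then {Clique 1} else {}). clique_weight (D - {d}) (q, f)) = clique_weight D (Suc q, f \<or> g)"
proof -
  let ?w = "Clique 1"
  define c where "c = card (D - {?w})"
  have weight_D: "clique_weight D (q', f') = (if ?w \<notin> D then falling_fact c q'
      else if f' then c * falling_fact c (q' - 1) else falling_fact (Suc c) q')" for q' f'
    unfolding clique_weight_def c_def Let_def prod.case ..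
  have card_less: "card (D - {d} - {?w}) = c - 1" if "d \<in> D - {?w}" for d
  proof -
    have "D - {d} - {?w} = D - {?w} - {d}" by auto
    then show ?thesis using that assms(1) by (simp add: c_def)
  qed
  \<comment> \<open>What remains if a vertex other than \<open>Clique 1\<close> is used; for \<open>c = 0\<close> there is none.\<close>
  define other where "other = (if ?w \<notin> D then falling_fact (c - 1) q
    else if f then (c - 1) * falling_fact (c - 1) (q - 1) else falling_fact (Suc (c - 1)) q)"
  have other: "clique_weight (D - {d}) (q, f) = other" if "d \<in> D - {?w}" for d
    using that card_less[OF that] by (auto simp: clique_weight_def other_def Let_def)
  have sum_other: "(\<Sum>d\<in>D - {?w}. clique_weight (D - {d}) (q, f)) = c * other"
    using sum.cong[OF refl other, of "D - {?w}"] by (simp add: c_def)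
  show ?thesis
  proof (cases g)
    case True
    then have "\<not> f" using assms(3) by blast
    then show ?thesis
      using True sum_other by (cases c) (simp_all add: weight_D other_def)
  next
    case False
    show ?thesis
    proof (cases "?w \<in> D")
      case w: True
      have "(\<Sum>d\<in>D. clique_weight (D - {d}) (q, f)) = clique_weight (D - {?w}) (q, f) + c * other"
        using sum.remove[OF assms(1) w, of "\<lambda>d. clique_weight (D - {d}) (q, f)"] sum_other by simp
      moreover have "clique_weight (D - {?w}) (q, f) = falling_fact c q"
        by (simp add: clique_weight_def c_def)
      moreover have "clique_weight D (Suc q, f) = (if f then c * falling_fact c q else Suc c * falling_fact c q)"
        using w by (simp add: weight_D)
      moreover have "falling_fact c q + c * other = (if f then c * falling_fact c q else Suc c * falling_fact c q)"
      proof (cases f)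
        case True
        then obtain r where "q = Suc r" using assms(2) by (cases q) auto
        then show ?thesis using True w by (cases c) (auto simp: other_def algebra_simps)
      next
        case False
        then show ?thesis using w by (cases c; cases q) (auto simp: other_def algebra_simps)
      qed
      ultimately show ?thesis using False by simp
    next
      case w: False
      then have "D - {?w} = D" by auto
      then show ?thesis
        using False w sum_other by (simp add: weight_D other_def)
    qed
  qed
qed

lemma sum_list_concat_map: "(\<Sum>z\<leftarrow>concat (map F Bs). h z) = (\<Sum>B\<leftarrow>Bs. \<Sum>z\<leftarrow>F B. h z :: nat)"
  by (induction Bs) auto

lemma sum_sum_list_swap: "(\<Sum>d\<in>X. \<Sum>z\<leftarrow>zs. h d z) = (\<Sum>z\<leftarrow>zs. \<Sum>d\<in>X. h d z :: nat)"
  by (induction zs) (auto simp: sum.distrib)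

text \<open>
  The prescribed sizes \<open>xs\<close> account for all classes but \<open>k\<close> single vertices, and these can
  be ordered in \<open>k!\<close> ways.
\<close>

lemma stable_count_F_graph:
  assumes "set A \<subseteq> set K33_vertices" "D \<subseteq> Clique ` {1..t}" "card (set A) + card D = sum_list xs + k"
  shows "stable_count (parcs (F_graph t)) (set A \<union> D) (xs @ replicate k 1) =
    fact k * (\<Sum>z\<leftarrow>profiles xs A. clique_weight D z)"
  using assms
proof (induction xs arbitrary: A D)
  case Nil
  have fin: "finite (set A)" "finite D" using Nil.prems by (auto intro: finite_subset)
  have "set A \<inter> D = {}" using Nil.prems by (auto simp: set_K33_vertices)
  then have "card (set A \<union> D) = k" using Nil.prems(3) fin by (simp add: card_Un_disjoint)
  moreover have "(v, v) \<notin> parcs (F_graph t)" for v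
    by (cases v) (auto simp: F_graph_def K33_minus_edge_def K33_def clique_def Let_def)
  ultimately show ?case
    using stable_count_ones[of "set A \<union> D" "parcs (F_graph t)" k] fin
    by (auto simp: clique_weight_def Let_def)
next
  case (Cons s xs)
  let ?E = "parcs (F_graph t)"
  let ?ys = "xs @ replicate k 1"
  let ?A = "\<lambda>B. filter (\<lambda>v. v \<notin> set B) A"
  let ?Bs = "filter (\<lambda>B. length B = s \<and> set B \<subseteq> set A) K33_stable_sets"
  let ?Cs = "filter (\<lambda>B. Suc (length B) = s \<and> set B \<subseteq> set A) K33_stable_sets"
  let ?D = "\<lambda>B. D - (if Left 1 \<in> set B then {Clique 1} else {})"
  have fin: "finite (set A)" "finite D" using Cons.prems by (auto intro: finite_subset)
  have disj: "set A \<inter> D = {}" using Cons.prems by (auto simp: set_K33_vertices)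
  have card_A: "card (set (?A B)) + length B = card (set A)" if "B \<in> set K33_stable_sets" "set B \<subseteq> set A" for B
  proof -
    have "set (?A B) = set A - set B" by auto
    then show ?thesis
      using that card_mono[OF fin(1) that(2)] by (simp add: card_Diff_subset length_K33_stable_set)
  qed
  have case0: "stable_count ?E (set A \<union> D - set B) ?ys = fact k * (\<Sum>z\<leftarrow>profiles xs (?A B). clique_weight D z)"
    if "B \<in> set ?Bs" for B
  proof -
    have "set A \<union> D - set B = set (?A B) \<union> D" using that disj by auto
    then show ?thesis
      using that Cons.prems card_A[of B] by (simp only:) (intro Cons.IH, auto)
  qed
  have case1: "(\<Sum>d\<in>?D B. stable_count ?E (set A \<union> D - insert d (set B)) ?ys) =
      fact k * (\<Sum>(q, f)\<leftarrow>profiles xs (?A B). clique_weight D (Suc q, f \<or> Left 1 \<in> set B))"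
    if B: "B \<in> set ?Cs" for B
  proof -
    have "(\<Sum>d\<in>?D B. stable_count ?E (set A \<union> D - insert d (set B)) ?ys) =
        (\<Sum>d\<in>?D B. fact k * (\<Sum>z\<leftarrow>profiles xs (?A B). clique_weight (D - {d}) z))"
    proof (rule sum.cong)
      fix d assume d: "d \<in> ?D B"
      then have "d \<in> D" by auto
      have eq: "set A \<union> D - insert d (set B) = set (?A B) \<union> (D - {d})"
        using B disj \<open>d \<in> D\<close> by auto
      have "card (set (?A B)) + card (D - {d}) = sum_list xs + k"
        using B Cons.prems(3) card_A[of B] card_Suc_Diff1[OF fin(2) \<open>d \<in> D\<close>] by auto
      then show "stable_count ?E (set A \<union> D - insert d (set B)) ?ys =
          fact k * (\<Sum>z\<leftarrow>profiles xs (?A B). clique_weight (D - {d}) z)"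
        unfolding eq using Cons.prems by (intro Cons.IH) auto
    qed simp
    also have "\<dots> = fact k * (\<Sum>z\<leftarrow>profiles xs (?A B). \<Sum>d\<in>?D B. clique_weight (D - {d}) z)"
      by (simp only: sum_distrib_left[symmetric] sum_sum_list_swap)
    also have "(\<Sum>z\<leftarrow>profiles xs (?A B). \<Sum>d\<in>?D B. clique_weight (D - {d}) z) =
        (\<Sum>(q, f)\<leftarrow>profiles xs (?A B). clique_weight D (Suc q, f \<or> Left 1 \<in> set B))"
    proof (rule arg_cong[where f = sum_list], rule map_cong[OF refl], clarify)
      fix q f assume "(q, f) \<in> set (profiles xs (?A B))"
      then show "(\<Sum>d\<in>?D B. clique_weight (D - {d}) (q, f)) = clique_weight D (Suc q, f \<or> Left 1 \<in> set B)"
        using profiles_flag[of q f xs "?A B"] by (intro sum_clique_weight fin) auto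
    qed
    finally show ?thesis .
  qed
  have "stable_count ?E (set A \<union> D) ((s # xs) @ replicate k 1) =
      (\<Sum>B\<leftarrow>?Bs. stable_count ?E (set A \<union> D - set B) ?ys) +
      (\<Sum>B\<leftarrow>?Cs. \<Sum>d\<in>?D B. stable_count ?E (set A \<union> D - insert d (set B)) ?ys)"
  proof (cases s)
    case 0
    then show ?thesis
      using sum_F_graph_stable_sets[OF Cons.prems(1,2), where s = s and h = "\<lambda>B. stable_count ?E (set A \<union> D - B) ?ys"]
        sum_K33_stable_sets[OF Cons.prems(1), where h = "\<lambda>B. stable_count ?E (set A \<union> D - B) ?ys"]
      by simp
  next
    case (Suc s')
    then show ?thesis
      using sum_F_graph_stable_sets[OF Cons.prems(1,2), where s = s and h = "\<lambda>B. stable_count ?E (set A \<union> D - B) ?ys"]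
        sum_K33_stable_sets[OF Cons.prems(1), where h = "\<lambda>B. stable_count ?E (set A \<union> D - B) ?ys"]
        sum_K33_stable_sets[OF Cons.prems(1), where t = t and s = s' and
          h = "\<lambda>B. \<Sum>d\<in>D - (if Left 1 \<in> B then {Clique 1} else {}). stable_count ?E (set A \<union> D - insert d B) ?ys"]
      by simp
  qed
  also have "(\<Sum>B\<leftarrow>?Bs. stable_count ?E (set A \<union> D - set B) ?ys) =
      (\<Sum>B\<leftarrow>?Bs. fact k * (\<Sum>z\<leftarrow>profiles xs (?A B). clique_weight D z))"
    by (rule arg_cong[where f = sum_list], rule map_cong[OF refl], rule case0)
  also have "(\<Sum>B\<leftarrow>?Cs. \<Sum>d\<in>?D B. stable_count ?E (set A \<union> D - insert d (set B)) ?ys) =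
      (\<Sum>B\<leftarrow>?Cs. fact k * (\<Sum>(q, f)\<leftarrow>profiles xs (?A B). clique_weight D (Suc q, f \<or> Left 1 \<in> set B)))"
    by (rule arg_cong[where f = sum_list], rule map_cong[OF refl], rule case1)
  finally show ?case
    by (simp add: sum_list_concat_map sum_list_const_mult distrib_left comp_def case_prod_beta')
qed

section \<open>Coefficients as polynomials\<close>

text \<open>
  Polynomials in \<open>s = t - 6\<close> are coefficient lists, constant term first. In this form they can
  be computed by rewriting and compared coefficient by coefficient.
\<close>

fun evalp :: "int list \<Rightarrow> int \<Rightarrow> int" where
  "evalp [] x = 0"
| "evalp (a # p) x = a + x * evalp p x"

fun padd :: "int list \<Rightarrow> int list \<Rightarrow> int list" where
  "padd [] q = q"
| "padd p [] = p"
| "padd (a # p) (b # q) = (a + b) # padd p q"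

fun pmul :: "int list \<Rightarrow> int list \<Rightarrow> int list" where
  "pmul [] q = []"
| "pmul (a # p) q = padd (map ((*) a) q) (0 # pmul p q)"

text \<open>
  The polynomial $(s + k)(s + k - 1) \cdots (s + k - q + 1)$.
\<close>

fun falling_poly :: "int \<Rightarrow> nat \<Rightarrow> int list" where
  "falling_poly k 0 = [1]"
| "falling_poly k (Suc q) = pmul [k, 1] (falling_poly (k - 1) q)"

text \<open>
  The clique has $s + 6$ vertices, $s + 5$ of them different from \<open>Clique 1\<close>.
\<close>

fun weight_poly :: "nat \<times> bool \<Rightarrow> int list" where
  "weight_poly (q, f) = (if f then pmul [5, 1] (falling_poly 5 (q - 1)) else falling_poly 6 q)"

fun tally_add :: "'a \<times> int \<Rightarrow> ('a \<times> int) list \<Rightarrow> ('a \<times> int) list" where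
  "tally_add (z, m) [] = [(z, m)]"
| "tally_add (z, m) ((y, n) # T) = (if z = y then (y, m + n) # T else (y, n) # tally_add (z, m) T)"

text \<open>
  The same choices as in \<open>profiles\<close>, listed with multiplicities. Merging equal profiles at every
  step keeps the lists short, so that all 30 polynomials can be computed by rewriting.
\<close>

fun profile_tally :: "nat list \<Rightarrow> vertex list \<Rightarrow> ((nat \<times> bool) \<times> int) list" where
  "profile_tally [] A = [((0, False), 1)]"
| "profile_tally (s # xs) A = foldr (foldr tally_add)
    (map (\<lambda>B. profile_tally xs (filter (\<lambda>v. v \<notin> set B) A))
      (filter (\<lambda>B. length B = s \<and> set B \<subseteq> set A) K33_stable_sets) @
    map (\<lambda>B. map (\<lambda>((q, f), n). ((Suc q, f \<or> Left 1 \<in> set B), n)) (profile_tally xs (filter (\<lambda>v. v \<notin> set B) A)))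
      (filter (\<lambda>B. Suc (length B) = s \<and> set B \<subseteq> set A) K33_stable_sets)) []"

fun tally_poly :: "((nat \<times> bool) \<times> int) list \<Rightarrow> int list" where
  "tally_poly [] = []"
| "tally_poly ((z, n) # T) = padd (map ((*) n) (weight_poly z)) (tally_poly T)"

text \<open>
  Let d be 12 minus the size and the length of \<open>\<rho>\<close>. Then $s + d$ parts of the partition of
  $s + 12$ that belongs to \<open>\<rho>\<close> are equal to 1. They contribute the factor $(s + d)!$, of which
  the polynomial keeps $(s + d)! / s!$.
\<close>

definition coeff_poly :: "nat list \<Rightarrow> int list" where
  "coeff_poly \<rho> =
     pmul (falling_poly (12 - int (sum_list \<rho>) - int (length \<rho>)) (12 - sum_list \<rho> - length \<rho>))
       (tally_poly (profile_tally (map Suc \<rho>) K33_vertices))"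

lemma evalp_padd [simp]: "evalp (padd p q) x = evalp p x + evalp q x"
  by (induction p q rule: padd.induct) (auto simp: algebra_simps)

lemma evalp_smult [simp]: "evalp (map ((*) a) p) x = a * evalp p x"
  by (induction p) (auto simp: algebra_simps)

lemma evalp_pmul [simp]: "evalp (pmul p q) x = evalp p x * evalp q x"
  by (induction p) (auto simp: algebra_simps)

definition tally_sum :: "('a \<Rightarrow> int) \<Rightarrow> ('a \<times> int) list \<Rightarrow> int" where
  "tally_sum h T = (\<Sum>(z, n)\<leftarrow>T. n * h z)"

lemma tally_sum_simps [simp]:
  "tally_sum h [] = 0"
  "tally_sum h ((z, n) # T) = n * h z + tally_sum h T"
  by (simp_all add: tally_sum_def)

lemma tally_sum_add: "tally_sum h (tally_add (z, m) T) = m * h z + tally_sum h T"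
  by (induction T) (auto simp: algebra_simps)

lemma tally_sum_foldr: "tally_sum h (foldr tally_add T U) = tally_sum h T + tally_sum h U"
  by (induction T) (auto simp: tally_sum_add)

lemma tally_sum_foldr_foldr:
  "tally_sum h (foldr (foldr tally_add) Ts U) = (\<Sum>T\<leftarrow>Ts. tally_sum h T) + tally_sum h U"
  by (induction Ts) (simp_all add: tally_sum_foldr)

lemma tally_sum_profile_tally: "tally_sum h (profile_tally xs A) = (\<Sum>z\<leftarrow>profiles xs A. h z)"
proof (induction xs arbitrary: A h)
  case Nil
  then show ?case by simp
next
  case (Cons s xs)
  have shift: "tally_sum h (map (\<lambda>x. ((Suc (fst (fst x)), snd (fst x) \<or> b), snd x)) T) =
      tally_sum (\<lambda>z. h (Suc (fst z), snd z \<or> b)) T" for b T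
    by (simp add: tally_sum_def comp_def case_prod_beta')
  have concat: "(\<Sum>z\<leftarrow>concat (map F Bs). h z) = (\<Sum>B\<leftarrow>Bs. \<Sum>z\<leftarrow>F B. h z)" for F :: "vertex list \<Rightarrow> _" and Bs
    by (induction Bs) auto
  show ?case
    by (simp add: tally_sum_foldr_foldr shift Cons.IH concat comp_def case_prod_beta')
qed

lemma evalp_tally_poly: "evalp (tally_poly T) x = tally_sum (\<lambda>z. evalp (weight_poly z) x) T"
  by (induction T rule: tally_poly.induct) (simp_all del: weight_poly.simps)

lemma falling_fact_eq_evalp: "int (falling_fact n q) = evalp (falling_poly (int n - x) q) x"
proof (induction q arbitrary: n)
  case (Suc q)
  show ?case
  proof (cases n)
    case (Suc m)
    have "int (falling_fact m q) = evalp (falling_poly (int n - x - 1) q) x"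
      using Suc.IH[of m] Suc by (simp add: algebra_simps)
    then show ?thesis using Suc by (simp add: algebra_simps)
  qed simp
qed simp

lemma fact_add_eq: "fact (s + d) = fact s * falling_fact (s + d) d"
  by (induction d) (auto simp: algebra_simps)

text \<open>
  The partitions of \<open>t + 6\<close> with at least \<open>t\<close> parts arise from partitions of numbers at
  most 6 in this way: add 1 to every part and fill up with parts 1.
\<close>

definition row_one_extension :: "nat \<Rightarrow> nat list \<Rightarrow> nat list" where
  "row_one_extension t \<rho> = map Suc \<rho> @ replicate (t + 6 - sum_list \<rho> - length \<rho>) 1"

lemma sum_list_map_Suc: "sum_list (map Suc xs) = sum_list xs + length xs"
  by (induction xs) auto

lemma chromatic_sym_F_graph_expo:
  assumes "sum_list \<rho> + length \<rho> \<le> 12"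
  shows "chromatic_sym (F_graph (s + 6)) (expo (row_one_extension (s + 6) \<rho>)) =
    fact s * evalp (coeff_poly \<rho>) (int s)"
proof -
  let ?t = "s + 6"
  define d where "d = 12 - sum_list \<rho> - length \<rho>"
  have int_d: "12 - int (sum_list \<rho>) - int (length \<rho>) = int d"
    using assms by (simp add: d_def)
  have n: "?t + 6 - sum_list \<rho> - length \<rho> = s + d"
    using assms by (simp add: d_def)
  let ?D = "Clique ` {1..?t}"
  let ?ps = "profiles (map Suc \<rho>) K33_vertices"
  have card_D: "card ?D = ?t" by (simp add: card_image inj_on_def)
  have card_H: "card (set K33_vertices) = 6"
    by (simp add: distinct_card[OF distinct_K33_vertices]) (simp add: K33_vertices_def)
  have "chromatic_sym (F_graph ?t) (expo (row_one_extension ?t \<rho>)) =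
      int (stable_count (parcs (F_graph ?t)) (set K33_vertices \<union> ?D) (map Suc \<rho> @ replicate (s + d) 1))"
    unfolding row_one_extension_def n
    by (subst chromatic_sym_expo[OF pair_graph_F_graph]) (simp_all add: pverts_F_graph)
  also have "\<dots> = int (fact (s + d) * (\<Sum>z\<leftarrow>?ps. clique_weight ?D z))"
  proof (subst stable_count_F_graph)
    show "card (set K33_vertices) + card ?D = sum_list (map Suc \<rho>) + (s + d)"
      using assms unfolding card_H card_D sum_list_map_Suc by (simp add: d_def)
  qed auto
  also have "\<dots> = fact s * (int (falling_fact (s + d) d) * int (\<Sum>z\<leftarrow>?ps. clique_weight ?D z))"
    by (simp add: fact_add_eq)
  also have "int (falling_fact (s + d) d) = evalp (falling_poly (int d) d) (int s)"
    by (simp add: falling_fact_eq_evalp[of _ _ "int s"])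
  also have "int (\<Sum>z\<leftarrow>?ps. clique_weight ?D z) = evalp (tally_poly (profile_tally (map Suc \<rho>) K33_vertices)) (int s)"
  proof -
    have "?D - {Clique 1} = Clique ` {2..?t}" by auto
    then have card5: "card (?D - {Clique 1}) = s + 5"
      by (simp add: card_image inj_on_def)
    have "int (clique_weight ?D z) = evalp (weight_poly z) (int s)" for z
    proof (cases z)
      case (Pair q f)
      have "Clique 1 \<in> ?D" by auto
      then have "clique_weight ?D z = (if f then (s + 5) * falling_fact (s + 5) (q - 1) else falling_fact (s + 6) q)"
        unfolding Pair clique_weight_def prod.case card5 Let_def by (simp add: eval_nat_numeral)
      then show ?thesis
        by (simp add: Pair falling_fact_eq_evalp[of _ _ "int s"] algebra_simps)
    qed
    then have "int (\<Sum>z\<leftarrow>zs. clique_weight ?D z) = (\<Sum>z\<leftarrow>zs. evalp (weight_poly z) (int s))" for zs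
      by (induction zs) (simp_all del: weight_poly.simps)
    then show ?thesis unfolding evalp_tally_poly tally_sum_profile_tally .
  qed
  finally show ?thesis
    using int_d unfolding coeff_poly_def d_def[symmetric] by simp
qed

section \<open>Partitions of size at most six\<close>

text \<open>
  Partitions with at most \<open>l\<close> parts, each at most \<open>m\<close>, of numbers up to \<open>n\<close>.
\<close>

fun bounded_partitions :: "nat \<Rightarrow> nat \<Rightarrow> nat \<Rightarrow> nat list list" where
  "bounded_partitions 0 n m = [[]]"
| "bounded_partitions (Suc l) n m =
    [] # concat (map (\<lambda>k. map ((#) k) (bounded_partitions l (n - k) k)) [1..<Suc (min n m)])"

lemma mem_bounded_partitions:
  "is_partition \<rho> \<Longrightarrow> length \<rho> \<le> l \<Longrightarrow> sum_list \<rho> \<le> n \<Longrightarrow> \<forall>x\<in>set \<rho>. x \<le> m \<Longrightarrow>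
    \<rho> \<in> set (bounded_partitions l n m)"
proof (induction l arbitrary: \<rho> n m)
  case (Suc l)
  show ?case
  proof (cases \<rho>)
    case (Cons k \<sigma>)
    have "\<sigma> \<in> set (bounded_partitions l (n - k) k)"
      using Suc.prems Cons by (intro Suc.IH) (auto simp: is_partition_def)
    moreover have "k \<in> set [1..<Suc (min n m)]"
      using Suc.prems Cons by (auto simp: is_partition_def)
    ultimately show ?thesis
      unfolding Cons bounded_partitions.simps list.set set_concat set_map image_comp comp_def by blast
  qed simp
qed simp

text \<open>
  For every partition of a number at most 6 its polynomial. It is zero as soon as a part exceeds 3,
  because the largest stable sets of $K_{3,3}$ minus an edge have three elements.
\<close>

definition coeff_table :: "(nat list \<times> int list) list" where
  "coeff_table = [
    ([], [479001600, 1486442880, 1931559552, 1414014888, 657206836, 206070150, 44990231, 6926634, 749463, 55770, 2717, 78, 1]),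
    ([1], [152409600, 468175680, 599422032, 429720456, 193968060, 58387890, 12038796, 1708938, 164340, 10230, 372, 6]),
    ([2], [14878080, 44629776, 55266732, 37879780, 16108085, 4479468, 830361, 101820, 7935, 356, 7]),
    ([1, 1], [48384000, 146661120, 184161984, 128442944, 55781304, 15902544, 3034206, 384576, 31116, 1456, 30]),
    ([3], [443520, 1286064, 1518532, 976372, 381507, 94794, 15078, 1488, 83, 2]),
    ([2, 1], [4662000, 13700700, 16469980, 10829469, 4346776, 1114582, 183820, 18901, 1104, 28]),
    ([1, 1, 1], [15249600, 45405360, 55537968, 37310916, 15364608, 4058880, 692592, 74004, 4512, 120]),
    ([4], [0, 0, 0, 0, 0, 0, 0, 0]),
    ([3, 1], [138960, 389412, 437704, 262871, 93499, 20363, 2671, 194, 6]),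
    ([2, 2], [468000, 1317960, 1491272, 903070, 324408, 71470, 9498, 700, 22]),
    ([2, 1, 1], [1409280, 4027376, 4646804, 2882370, 1065086, 242334, 33386, 2560, 84]),
    ([1, 1, 1, 1], [4743360, 13765392, 16208184, 10306368, 3920520, 921888, 131736, 10512, 360]),
    ([5], [0, 0, 0, 0, 0, 0, 0]),
    ([4, 1], [0, 0, 0, 0, 0, 0]),
    ([3, 2], [19920, 53044, 55332, 29929, 9195, 1621, 153, 6]),
    ([3, 1, 1], [37440, 100128, 105068, 57258, 17750, 3162, 302, 12]),
    ([2, 2, 1], [120240, 324948, 345810, 191726, 60630, 11042, 1080, 44]),
    ([2, 1, 1, 1], [403920, 1103724, 1191798, 672342, 216810, 40326, 4032, 168]),
    ([1, 1, 1, 1, 1], [1440000, 4008000, 4430400, 2567280, 852000, 163200, 16800, 720]),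
    ([6], [0, 0, 0, 0, 0, 0]),
    ([5, 1], [0, 0, 0, 0, 0]),
    ([4, 2], [0, 0, 0, 0, 0]),
    ([4, 1, 1], [0, 0, 0, 0]),
    ([3, 3], [1200, 2980, 2798, 1300, 320, 40, 2]),
    ([3, 2, 1], [3600, 8940, 8394, 3900, 960, 120, 6]),
    ([3, 1, 1, 1], [7200, 17880, 16788, 7800, 1920, 240, 12]),
    ([2, 2, 2], [3600, 8940, 8394, 3900, 960, 120, 6]),
    ([2, 2, 1, 1], [26400, 65560, 61556, 28600, 7040, 880, 44]),
    ([2, 1, 1, 1, 1], [100800, 250320, 235032, 109200, 26880, 3360, 168]),
    ([1, 1, 1, 1, 1, 1], [432000, 1072800, 1007280, 468000, 115200, 14400, 720])]"

lemma coeff_table_correct: "list_all (\<lambda>(\<rho>, p). coeff_poly \<rho> = p) coeff_table"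
  by code_simp

lemma coeff_table_complete: "list_all (\<lambda>\<rho>. \<rho> \<in> set (map fst coeff_table)) (bounded_partitions 6 6 6)"
  by code_simp

fun coeffwise_le :: "int list \<Rightarrow> int list \<Rightarrow> bool" where
  "coeffwise_le [] q \<longleftrightarrow> list_all (\<lambda>a. 0 \<le> a) q"
| "coeffwise_le p [] \<longleftrightarrow> list_all (\<lambda>a. a \<le> 0) p"
| "coeffwise_le (a # p) (b # q) \<longleftrightarrow> a \<le> b \<and> coeffwise_le p q"

text \<open>
  Dominance without equality of the totals. Prefixes of length up to 6 suffice, since a partition of
  a number at most 6 has at most 6 parts.
\<close>

definition weakly_dominates :: "nat list \<Rightarrow> nat list \<Rightarrow> bool" where
  "weakly_dominates \<rho> \<sigma> \<longleftrightarrow> list_all (\<lambda>k. sum_list (take k \<sigma>) \<le> sum_list (take k \<rho>)) [0..<7]"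

text \<open>
  The finite check behind strong niceness. It holds for the coefficients separately, so nothing about
  the size of \<open>s\<close> enters beyond \<open>s \<ge> 0\<close>.
\<close>

lemma coeff_table_monotone:
  "list_all (\<lambda>(\<rho>, p). list_all (\<lambda>(\<sigma>, q). weakly_dominates \<rho> \<sigma> \<longrightarrow> coeffwise_le p q) coeff_table) coeff_table"
  by code_simp

text \<open>
  Among the partitions of 6 that dominate (2,2,2), only (2,2,2), (3,2,1) and (3,3) have no part
  greater than 3; whatever dominates one of the others has such a part as well.
\<close>

lemma coeff_table_vanishing:
  "list_all (\<lambda>(\<rho>, p). list_all (\<lambda>(\<sigma>, q). sum_list \<rho> = 6 \<longrightarrow> sum_list \<sigma> = 6 \<longrightarrow>
     weakly_dominates \<sigma> [2, 2, 2] \<longrightarrow> \<sigma> \<notin> set [[3, 3], [3, 2, 1], [2, 2, 2]] \<longrightarrow>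
     weakly_dominates \<rho> \<sigma> \<longrightarrow> list_all (\<lambda>a. a = 0) p) coeff_table) coeff_table"
  by code_simp

lemma evalp_nonneg: "list_all (\<lambda>a. 0 \<le> a) p \<Longrightarrow> 0 \<le> x \<Longrightarrow> 0 \<le> evalp p x"
  by (induction p) auto

lemma evalp_nonpos: "list_all (\<lambda>a. a \<le> 0) p \<Longrightarrow> 0 \<le> x \<Longrightarrow> evalp p x \<le> 0"
  by (induction p) (auto intro!: add_nonpos_nonpos simp: mult_nonneg_nonpos)

lemma evalp_eq_0: "list_all (\<lambda>a. a = 0) p \<Longrightarrow> evalp p x = 0"
  by (induction p) auto

lemma evalp_mono: "coeffwise_le p q \<Longrightarrow> 0 \<le> x \<Longrightarrow> evalp p x \<le> evalp q x"
proof (induction p q rule: coeffwise_le.induct)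
  case (1 q)
  then show ?case using evalp_nonneg[of q x] by simp
next
  case (2 a p)
  then show ?case using evalp_nonpos[of "a # p" x] by simp
next
  case (3 a p b q)
  then show ?case by (simp add: add_mono mult_left_mono)
qed

lemma length_le_sum_list: "is_partition \<rho> \<Longrightarrow> length \<rho> \<le> sum_list \<rho>"
proof (induction \<rho>)
  case (Cons x \<rho>)
  then have "length \<rho> \<le> sum_list \<rho>" "x \<noteq> 0" by (auto simp: is_partition_def)
  then show ?case by simp
qed simp

lemma coeff_table_mem:
  assumes "is_partition \<rho>" "sum_list \<rho> \<le> 6"
  shows "(\<rho>, coeff_poly \<rho>) \<in> set coeff_table"
proof -
  have "\<rho> \<in> set (bounded_partitions 6 6 6)"
  proof (rule mem_bounded_partitions)
    show "\<forall>x\<in>set \<rho>. x \<le> 6"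
      using member_le_sum_list[of _ \<rho>] assms(2) by fastforce
  qed (use assms length_le_sum_list[OF assms(1)] in simp_all)
  then have "\<rho> \<in> set (map fst coeff_table)"
    by (rule coeff_table_complete[unfolded list_all_iff, rule_format])
  then obtain p where p: "(\<rho>, p) \<in> set coeff_table"
    unfolding set_map by (elim imageE) (metis prod.collapse)
  have "coeff_poly \<rho> = p"
    using coeff_table_correct[unfolded list_all_iff, rule_format, OF p] by (simp only: prod.case)
  then show ?thesis using p by (simp only:)
qed

lemma partition_ones_split:
  "is_partition \<mu> \<Longrightarrow> \<exists>\<rho> n. is_partition \<rho> \<and> \<mu> = map Suc \<rho> @ replicate n 1"
proof (induction \<mu>)
  case Nil
  then show ?case by (intro exI[of _ "[]"] exI[of _ 0]) simp
next
  case (Cons x \<mu>)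
  then obtain \<rho> n where \<rho>: "is_partition \<rho>" "\<mu> = map Suc \<rho> @ replicate n 1"
    by (auto simp: is_partition_def)
  have x: "x \<noteq> 0" "\<forall>y\<in>set \<mu>. y \<le> x"
    using Cons.prems by (auto simp: is_partition_def)
  show ?case
  proof (cases "x = 1")
    case True
    have "\<rho> = []"
    proof (rule ccontr)
      assume "\<rho> \<noteq> []"
      then obtain y where y: "y \<in> set \<rho>" by (cases \<rho>) auto
      then have "Suc y \<le> 1" using x(2) True \<rho>(2) by auto
      then show False using y \<rho>(1) by (simp add: is_partition_def)
    qed
    then show ?thesis
      using \<rho> True by (intro exI[of _ "[]"] exI[of _ "Suc n"]) simp
  next
    case False
    have "y \<le> x - 1" if "y \<in> set \<rho>" for y
    proof -
      have "Suc y \<le> x" using x(2) \<rho>(2) that by simp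
      then show ?thesis by simp
    qed
    then have "is_partition ((x - 1) # \<rho>)"
      using x(1) False \<rho>(1) by (simp add: is_partition_def)
    moreover have "x # \<mu> = map Suc ((x - 1) # \<rho>) @ replicate n 1"
      using x(1) \<rho>(2) by simp
    ultimately show ?thesis by blast
  qed
qed

lemma partition_row_one_extension:
  assumes "is_partition \<mu>" "sum_list \<mu> = t + 6" "t \<le> length \<mu>"
  obtains \<rho> where "is_partition \<rho>" "sum_list \<rho> + length \<mu> = t + 6" "\<mu> = row_one_extension t \<rho>"
proof -
  obtain \<rho> n where \<rho>: "is_partition \<rho>" "\<mu> = map Suc \<rho> @ replicate n 1"
    using partition_ones_split[OF assms(1)] by blast
  have "sum_list \<rho> + length \<rho> + n = t + 6"
    using assms(2) unfolding \<rho>(2) by (simp add: sum_list_map_Suc sum_list_replicate)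
  then have "n = t + 6 - sum_list \<rho> - length \<rho>" "sum_list \<rho> + length \<mu> = t + 6"
    using \<rho>(2) by simp_all
  then show ?thesis
    using that \<rho> by (simp add: row_one_extension_def)
qed

lemma sum_list_take_row_one_extension:
  assumes "k \<le> length (row_one_extension t \<rho>)"
  shows "sum_list (take k (row_one_extension t \<rho>)) = sum_list (take k \<rho>) + k"
proof (cases "k \<le> length \<rho>")
  case True
  then show ?thesis
    by (simp add: row_one_extension_def take_map sum_list_map_Suc)
next
  case False
  then show ?thesis
    using assms by (simp add: row_one_extension_def sum_list_map_Suc sum_list_replicate)
qed

text \<open>
  Adding 1 to each of the first \<open>k\<close> parts changes both prefix sums by \<open>k\<close>, as long as both
  partitions have at least \<open>k\<close> parts.
\<close>

lemma weakly_dominates_row_one_extension: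
  assumes "dominates (row_one_extension t \<rho>) (row_one_extension t \<sigma>)"
    "6 \<le> length (row_one_extension t \<rho>)" "6 \<le> length (row_one_extension t \<sigma>)"
  shows "weakly_dominates \<rho> \<sigma>"
proof -
  have "sum_list (take k \<sigma>) \<le> sum_list (take k \<rho>)" if "k < 7" for k
  proof (cases "k = 0")
    case False
    then have "sum_list (take k (row_one_extension t \<sigma>)) \<le> sum_list (take k (row_one_extension t \<rho>))"
      using assms(1) by (simp add: dominates_def)
    then show ?thesis
      using assms(2,3) that by (simp add: sum_list_take_row_one_extension)
  qed simp
  then show ?thesis by (simp add: weakly_dominates_def list_all_iff)
qed

lemma chromatic_sym_F_graph_short:
  assumes "length xs < t" "t \<ge> 1"
  shows "chromatic_sym (F_graph t) (expo xs) = 0"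
proof -
  have "stable_count (parcs (F_graph t)) (pverts (F_graph t)) xs = 0"
  proof (rule stable_count_clique)
    show "Clique ` {1..t} \<subseteq> pverts (F_graph t)" by (simp add: pverts_F_graph)
    show "length xs < card (Clique ` {1..t})"
      using assms by (simp add: card_image inj_on_def)
  qed (auto simp: pverts_F_graph parcs_F_graph_clique)
  then show ?thesis
    using chromatic_sym_expo[OF pair_graph_F_graph[OF assms(2)]] by simp
qed

lemma card_pverts_F_graph: "card (pverts (F_graph t)) = t + 6"
proof -
  have "card (Clique ` {1..t}) = t" by (simp add: card_image inj_on_def)
  moreover have "card (set K33_vertices) = 6"
    by (simp add: distinct_card[OF distinct_K33_vertices]) (simp add: K33_vertices_def)
  moreover have "set K33_vertices \<inter> Clique ` {1..t} = {}"
    by (auto simp: K33_vertices_def)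
  ultimately show ?thesis
    unfolding pverts_F_graph by (subst card_Un_disjoint) auto
qed

section \<open>The graph $F_t$ is strongly nice\<close>

lemma strongly_nice_F_graph:
  assumes t: "t \<ge> 6"
  shows "strongly_nice (F_graph t)"
  unfolding strongly_nice_def card_pverts_F_graph
proof (intro ballI impI)
  obtain s where s: "t = s + 6" using t by (metis add.commute le_Suc_ex)
  have G: "pair_graph (F_graph t)" using t by (intro pair_graph_F_graph) simp
  let ?X = "chromatic_sym (F_graph t)"
  have coeff: "basis_coeff monomial_sym \<mu> ?X = ?X (expo \<mu>)" if "\<mu> \<in> partitions_of (t + 6)" for \<mu>
    using basis_coeff_monomial[OF symmetric_series_chromatic_sym[OF G] homogeneous_series_chromatic_sym[OF G]] that
    by (simp add: card_pverts_F_graph)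
  fix \<nu> \<mu> assume *: "\<nu> \<in> partitions_of (t + 6)" "\<mu> \<in> partitions_of (t + 6)" "dominates \<nu> \<mu>"
  then have \<nu>: "is_partition \<nu>" "sum_list \<nu> = t + 6" and \<mu>: "is_partition \<mu>" "sum_list \<mu> = t + 6"
    by (auto simp: partitions_of_def)
  have nonneg: "0 \<le> ?X (expo \<mu>)"
    by (simp add: chromatic_sym_expo[OF G])
  have "?X (expo \<nu>) \<le> ?X (expo \<mu>)"
  proof (cases "length \<nu> < t")
    case True
    then show ?thesis
      using chromatic_sym_F_graph_short[OF True] t nonneg by simp
  next
    case False
    then have len: "t \<le> length \<nu>" "t \<le> length \<mu>"
      using dominates_length_le[OF \<nu>(1) *(3)] \<nu>(2) \<mu>(2) by simp_all
    obtain \<rho> where \<rho>: "is_partition \<rho>" "sum_list \<rho> + length \<nu> = t + 6" "\<nu> = row_one_extension t \<rho>"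
      using partition_row_one_extension[OF \<nu> len(1)] .
    obtain \<sigma> where \<sigma>: "is_partition \<sigma>" "sum_list \<sigma> + length \<mu> = t + 6" "\<mu> = row_one_extension t \<sigma>"
      using partition_row_one_extension[OF \<mu> len(2)] .
    have small: "sum_list \<rho> \<le> 6" "sum_list \<sigma> \<le> 6" using \<rho>(2) \<sigma>(2) len by simp_all
    have "weakly_dominates \<rho> \<sigma>"
      using *(3) len t unfolding \<rho>(3) \<sigma>(3) by (intro weakly_dominates_row_one_extension) (assumption | linarith)+
    then have "coeffwise_le (coeff_poly \<rho>) (coeff_poly \<sigma>)"
      using coeff_table_monotone[unfolded list_all_iff, rule_format, OF coeff_table_mem[OF \<rho>(1) small(1)],
        unfolded prod.case list_all_iff, rule_format, OF coeff_table_mem[OF \<sigma>(1) small(2)]]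
      by (simp only: prod.case)
    then have "evalp (coeff_poly \<rho>) (int s) \<le> evalp (coeff_poly \<sigma>) (int s)"
      by (rule evalp_mono) simp
    moreover have "?X (expo \<nu>) = fact s * evalp (coeff_poly \<rho>) (int s)"
      unfolding \<rho>(3) s using small(1) length_le_sum_list[OF \<rho>(1)]
      by (intro chromatic_sym_F_graph_expo) simp
    moreover have "?X (expo \<mu>) = fact s * evalp (coeff_poly \<sigma>) (int s)"
      unfolding \<sigma>(3) s using small(2) length_le_sum_list[OF \<sigma>(1)]
      by (intro chromatic_sym_F_graph_expo) simp
    ultimately show ?thesis by (simp add: mult_left_mono)
  qed
  then show "basis_coeff monomial_sym \<nu> ?X \<le> basis_coeff monomial_sym \<mu> ?X"
    using coeff *(1,2) by simp
qed

section \<open>The Schur coefficient\<close>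

lemma row_one_extension_three:
  assumes "6 \<le> t"
  shows "row_one_extension t [3, 3] = 4 # 4 # 1 # replicate (t - 3) 1"
    "row_one_extension t [3, 2, 1] = 4 # 3 # 2 # replicate (t - 3) 1"
    "row_one_extension t [2, 2, 2] = 3 # 3 # 3 # replicate (t - 3) 1"
proof -
  have "t - Suc (Suc 0) = Suc (t - 3)" using assms by simp
  then have "replicate (t - Suc (Suc 0)) (1 :: nat) = 1 # replicate (t - 3) 1"
    by (simp only: replicate_Suc)
  then show "row_one_extension t [3, 3] = 4 # 4 # 1 # replicate (t - 3) 1"
    "row_one_extension t [3, 2, 1] = 4 # 3 # 2 # replicate (t - 3) 1"
    "row_one_extension t [2, 2, 2] = 3 # 3 # 3 # replicate (t - 3) 1"
    by (simp_all add: row_one_extension_def)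
qed

text \<open>
  The coefficients of the Schur expansion above \<open>p222\<close> vanish except at \<open>p33\<close> and
  \<open>p321\<close>. Comparing the coefficients of the three monomials that belong to \<open>p33\<close>,
  \<open>p321\<close> and \<open>p222\<close> gives three equations, solved from the top.
\<close>

lemma basis_coeff_schur_F_graph:
  assumes t: "t \<ge> 6"
  shows "basis_coeff schur (3 # 3 # 3 # replicate (t - 3) 1) (chromatic_sym (F_graph t)) =
    - 4 * (int t - 1) * fact (t - 1)"
proof -
  obtain s where s: "t = s + 6" using t by (metis add.commute le_Suc_ex)
  have G: "pair_graph (F_graph t)" using t by (intro pair_graph_F_graph) simp
  let ?X = "chromatic_sym (F_graph t)"
  let ?c = "\<lambda>\<mu>. basis_coeff schur \<mu> ?X"
  let ?K = "\<lambda>\<mu> \<nu>. schur \<mu> (expo \<nu>)"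
  define p33 p321 p222 where
    "p33 = 4 # 4 # 1 # replicate (t - 3) (1 :: nat)"
    and "p321 = 4 # 3 # 2 # replicate (t - 3) (1 :: nat)"
    and "p222 = 3 # 3 # 3 # replicate (t - 3) (1 :: nat)"
  note p_defs = p33_def p321_def p222_def
  have partition: "is_partition p33" "is_partition p321" "is_partition p222"
    by (auto simp: p_defs is_partition_def sorted_wrt_ge_replicate)
  have size: "sum_list p33 = t + 6" "sum_list p321 = t + 6" "sum_list p222 = t + 6"
    using t by (simp_all add: p_defs sum_list_replicate)
  have dom: "dominates p33 p222" "dominates p321 p222"
    by (auto simp: dominates_def p_defs take_Cons')
  have not_dom: "\<not> dominates p321 p33" "\<not> dominates p222 p33" "\<not> dominates p222 p321"
    by (auto simp: dominates_def p_defs not_le intro!: exI[of _ "2 :: nat"])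
  have ext: "p33 = row_one_extension t [3, 3]" "p321 = row_one_extension t [3, 2, 1]"
    "p222 = row_one_extension t [2, 2, 2]"
    unfolding p_defs row_one_extension_three[OF t] by (rule refl)+

  obtain S where S: "finite S" "S \<subseteq> Collect is_partition"
    and expansion: "\<And>\<alpha>. ?X \<alpha> = (\<Sum>\<mu>\<in>S. ?c \<mu> * schur \<mu> \<alpha>)"
    and outside: "\<And>\<mu>. is_partition \<mu> \<Longrightarrow> \<mu> \<notin> S \<Longrightarrow> ?c \<mu> = 0"
    using schur.expansion_in_span schur.symmetric_series_in_span[OF symmetric_series_schur homogeneous_series_schur
      symmetric_series_chromatic_sym[OF G] homogeneous_series_chromatic_sym[OF G]] by blast

  \<comment> \<open>Above a partition with fewer than t parts no coloring exists; for t parts the table of polynomials decides.\<close>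
  have zero: "?c \<mu> = 0" if \<mu>: "is_partition \<mu>" "sum_list \<mu> = t + 6" "dominates \<mu> p222" "\<mu> \<notin> {p33, p321, p222}" for \<mu>
  proof (cases "\<mu> \<in> S")
    case True
    have "?X (expo \<nu>) = 0" if \<nu>: "is_partition \<nu>" "sum_list \<nu> = sum_list \<mu>" "dominates \<nu> \<mu>" for \<nu>
    proof (cases "length \<nu> < t")
      case True
      then show ?thesis using chromatic_sym_F_graph_short t by simp
    next
      case False
      have "length \<nu> \<le> length \<mu>" "length \<mu> \<le> length p222"
        using dominates_length_le[OF \<nu>(1,3,2)] dominates_length_le[OF \<mu>(1,3)] \<mu>(2) size by simp_all
      moreover have "length p222 = t" using t by (simp add: p222_def)
      ultimately have len: "length \<nu> = t" "length \<mu> = t" using False by simp_all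
      have sum_\<nu>: "sum_list \<nu> = t + 6" using \<nu>(2) \<mu>(2) by simp
      obtain \<rho> where \<rho>: "is_partition \<rho>" "sum_list \<rho> + length \<nu> = t + 6" "\<nu> = row_one_extension t \<rho>"
        using partition_row_one_extension[OF \<nu>(1) sum_\<nu> eq_imp_le[OF len(1)[symmetric]]] .
      obtain \<sigma> where \<sigma>: "is_partition \<sigma>" "sum_list \<sigma> + length \<mu> = t + 6" "\<mu> = row_one_extension t \<sigma>"
        using partition_row_one_extension[OF \<mu>(1,2) eq_imp_le[OF len(2)[symmetric]]] .
      have six: "sum_list \<rho> = 6" "sum_list \<sigma> = 6" using \<rho>(2) \<sigma>(2) len by simp_all
      have "weakly_dominates \<rho> \<sigma>"
        using \<nu>(3) len t unfolding \<rho>(3) \<sigma>(3)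
        by (intro weakly_dominates_row_one_extension) (assumption | linarith)+
      moreover have "weakly_dominates \<sigma> [2, 2, 2]"
        using \<mu>(3) len t \<open>length p222 = t\<close> unfolding \<sigma>(3) ext(3)
        by (intro weakly_dominates_row_one_extension) (assumption | linarith)+
      moreover have "\<sigma> \<notin> set [[3, 3], [3, 2, 1], [2, 2, 2]]"
        using \<mu>(4) ext \<sigma>(3) by auto
      moreover have "(\<rho>, coeff_poly \<rho>) \<in> set coeff_table" "(\<sigma>, coeff_poly \<sigma>) \<in> set coeff_table"
        using coeff_table_mem \<rho>(1) \<sigma>(1) six by simp_all
      ultimately have "list_all (\<lambda>a. a = 0) (coeff_poly \<rho>)"
        using coeff_table_vanishing[unfolded list_all_iff[of _ coeff_table], rule_format, of "(\<rho>, coeff_poly \<rho>)",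
            unfolded prod.case list_all_iff[of _ coeff_table], rule_format, of "(\<sigma>, coeff_poly \<sigma>)",
            unfolded prod.case] six by blast
      moreover have "?X (expo \<nu>) = fact s * evalp (coeff_poly \<rho>) (int s)"
        unfolding \<rho>(3) s using six(1) length_le_sum_list[OF \<rho>(1)]
        by (intro chromatic_sym_F_graph_expo) simp
      ultimately show ?thesis by (simp add: evalp_eq_0)
    qed
    then show ?thesis
      by (intro schur.coeff_eq_0[OF S expansion True])
  qed (use outside \<mu> in blast)

  let ?T = "{p33, p321, p222}"
  \<comment> \<open>Only the three partitions contribute to these coefficients, whatever else the expansion contains.\<close>
  have X_at: "?X (expo \<nu>) = (\<Sum>\<mu>\<in>?T. ?c \<mu> * ?K \<mu> \<nu>)" if \<nu>: "\<nu> \<in> ?T" for \<nu>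
  proof -
    have \<nu>': "is_partition \<nu>" "sum_list \<nu> = t + 6" "dominates \<nu> p222"
      using \<nu> partition size dom dominates_refl by auto
    \<comment> \<open>A contribution at a monomial above \<open>p222\<close> can only come from partitions above it.\<close>
    have vanish: "?c \<mu> * ?K \<mu> \<nu> = 0" if \<mu>: "is_partition \<mu>" "\<mu> \<notin> ?T" for \<mu>
    proof (cases "?K \<mu> \<nu> = 0")
      case False
      then have "sum_list \<mu> = sum_list \<nu>" "dominates \<mu> \<nu>"
        using schur.off_diagonal[OF \<mu>(1) \<nu>'(1)] by simp_all
      then have "?c \<mu> = 0"
        using \<mu> \<nu>'(2) dominates_trans[OF _ \<nu>'(3)] by (intro zero) simp_all
      then show ?thesis by simp
    qed simp
    have "?X (expo \<nu>) = (\<Sum>\<mu>\<in>S. ?c \<mu> * ?K \<mu> \<nu>)" by (rule expansion)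
    also have "\<dots> = (\<Sum>\<mu>\<in>S \<union> ?T. ?c \<mu> * ?K \<mu> \<nu>)"
    proof (rule sum.mono_neutral_left)
      show "\<forall>\<mu>\<in>S \<union> ?T - S. ?c \<mu> * ?K \<mu> \<nu> = 0"
      proof
        fix \<mu> assume "\<mu> \<in> S \<union> ?T - S"
        then have "is_partition \<mu>" "\<mu> \<notin> S" using partition by auto
        then show "?c \<mu> * ?K \<mu> \<nu> = 0" using outside by simp
      qed
    qed (use S(1) in auto)
    also have "\<dots> = (\<Sum>\<mu>\<in>?T. ?c \<mu> * ?K \<mu> \<nu>)"
    proof (rule sum.mono_neutral_right)
      show "\<forall>\<mu>\<in>S \<union> ?T - ?T. ?c \<mu> * ?K \<mu> \<nu> = 0"
        using vanish S(2) by blast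
    qed (use S(1) in auto)
    finally show ?thesis .
  qed
  have distinct: "p33 \<noteq> p321" "p33 \<noteq> p222" "p321 \<noteq> p222" by (simp_all add: p_defs)
  have sum_T: "(\<Sum>\<mu>\<in>?T. h \<mu>) = h p33 + h p321 + h p222" for h :: "nat list \<Rightarrow> int"
    using distinct by simp

  have diag: "?K p33 p33 = 1" "?K p321 p321 = 1" "?K p222 p222 = 1"
    using schur.diagonal partition by simp_all
  have off: "?K p321 p33 = 0" "?K p222 p33 = 0" "?K p222 p321 = 0"
    using schur.off_diagonal partition not_dom by blast+
  have kostka: "?K p33 p321 = 1" "?K p33 p222 = 1" "?K p321 p222 = 2"
    using kostka_441_432[of "t - 3"] kostka_441_333[of "t - 3"] kostka_432_333[of "t - 3"]
    unfolding schur_expo[OF partition(1)] schur_expo[OF partition(2)] unfolding p_defs by simp_all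

  have table: "coeff_poly [3, 3] = [1200, 2980, 2798, 1300, 320, 40, 2]"
    "coeff_poly [3, 2, 1] = [3600, 8940, 8394, 3900, 960, 120, 6]"
    "coeff_poly [2, 2, 2] = [3600, 8940, 8394, 3900, 960, 120, 6]"
    using coeff_table_correct unfolding coeff_table_def by simp_all
  \<comment> \<open>The polynomial is $(s + 5) (s + 5) (s + 4) (s + 3) (s + 2) (s + 1)$, so this is (t - 1) (t - 1)!.\<close>
  define z where "z = fact s * evalp [600, 1490, 1399, 650, 160, 20, 1] (int s)"
  have small: "sum_list [3, 3] + length [3, 3 :: nat] \<le> 12" "sum_list [3, 2, 1] + length [3, 2, 1 :: nat] \<le> 12"
    "sum_list [2, 2, 2] + length [2, 2, 2 :: nat] \<le> 12"
    by simp_all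
  have X: "?X (expo p33) = 2 * z" "?X (expo p321) = 6 * z" "?X (expo p222) = 6 * z"
    unfolding ext s chromatic_sym_F_graph_expo[OF small(1)] chromatic_sym_F_graph_expo[OF small(2)]
      chromatic_sym_F_graph_expo[OF small(3)] table z_def
    by (simp_all add: algebra_simps)
  have "?c p33 = 2 * z"
    using X_at[of p33] unfolding sum_T by (simp add: X diag off)
  moreover have "?c p33 + ?c p321 = 6 * z"
    using X_at[of p321] unfolding sum_T by (simp add: X diag off kostka)
  moreover have "?c p33 + 2 * ?c p321 + ?c p222 = 6 * z"
    using X_at[of p222] unfolding sum_T by (simp add: X diag off kostka)
  ultimately have "?c p222 = - 4 * z" by linarith
  moreover have "z = (int t - 1) * fact (t - 1)"
  proof -
    have "t - 1 = Suc (Suc (Suc (Suc (Suc s))))" using s by simp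
    then have "(fact (t - 1) :: int) = (int s + 5) * ((int s + 4) * ((int s + 3) * ((int s + 2) * ((int s + 1) * fact s))))"
      by (simp add: algebra_simps)
    then show ?thesis
      unfolding z_def s by (simp add: algebra_simps)
  qed
  ultimately show ?thesis unfolding p222_def by (simp only: mult.assoc)
qed

section \<open>Connectedness\<close>

lemma connected_F_graph:
  assumes "t \<ge> 1"
  shows "Digraph_Component.connected (with_proj (F_graph t))"
proof -
  interpret pair_graph "F_graph t" using assms by (rule pair_graph_F_graph)
  let ?G = "with_proj (F_graph t)"
  have arc: "u \<rightarrow>\<^sup>*\<^bsub>?G\<^esub> v" if "(u, v) \<in> parcs (F_graph t)" for u v
    using that by (intro reachable_adjI) simp
  note F_defs = F_graph_def K33_minus_edge_def K33_def clique_def Let_def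
  have reach: "Left 1 \<rightarrow>\<^sup>*\<^bsub>?G\<^esub> v" if v: "v \<in> pverts (F_graph t)" for v
  proof -
    have L1: "Left 1 \<rightarrow>\<^sup>*\<^bsub>?G\<^esub> Right 2"
      by (rule arc) (auto simp: F_defs)
    have "Right 2 \<rightarrow>\<^sup>*\<^bsub>?G\<^esub> Left i" if "i \<in> {1..3}" for i
      by (rule arc) (use that in \<open>auto simp: F_defs\<close>)
    then have L: "Left 1 \<rightarrow>\<^sup>*\<^bsub>?G\<^esub> Left i" if "i \<in> {1..3}" for i
      using reachable_trans[OF L1] that by blast
    have "Left 2 \<rightarrow>\<^sup>*\<^bsub>?G\<^esub> Right i" if "i \<in> {1..3}" for i
      by (rule arc) (use that in \<open>auto simp: F_defs\<close>)
    then have R: "Left 1 \<rightarrow>\<^sup>*\<^bsub>?G\<^esub> Right i" if "i \<in> {1..3}" for i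
      using reachable_trans[OF L[of 2]] that by simp
    have C1: "Left 1 \<rightarrow>\<^sup>*\<^bsub>?G\<^esub> Clique 1"
      by (rule arc) (simp add: F_defs)
    have "Clique 1 \<rightarrow>\<^sup>*\<^bsub>?G\<^esub> Clique i" if "i \<in> {1..t}" "i \<noteq> 1" for i
      by (rule arc) (use that in \<open>auto simp: F_defs\<close>)
    then have C: "Left 1 \<rightarrow>\<^sup>*\<^bsub>?G\<^esub> Clique i" if "i \<in> {1..t}" for i
      using C1 reachable_trans[OF C1] that by (cases "i = 1") blast+
    show ?thesis
      using v L R C by (cases v) (auto simp: pverts_F_graph set_K33_vertices)
  qed
  have "u \<rightarrow>\<^sup>*\<^bsub>?G\<^esub> v" if "u \<in> pverts (F_graph t)" "v \<in> pverts (F_graph t)" for u v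
    using symmetric_reachable[OF sym_arcs reach[OF that(1)]] reach[OF that(2)] by (rule reachable_trans)
  then show ?thesis
    unfolding connected_def
    by (intro strongly_connectedI) (auto simp: reachable_mk_symmetric_eq[OF sym_arcs] pverts_F_graph K33_vertices_def)
qed

theorem theorem1p2:
  fixes t :: nat
  assumes "t \<ge> 6"
  shows "Digraph_Component.connected (with_proj (F_graph t)) \<and>
    strongly_nice (F_graph t) \<and>
    \<not> schur_positive (F_graph t) \<and>
    basis_coeff schur ([3, 3, 3] @ replicate (t - 3) 1) (chromatic_sym (F_graph t))
      = - 4 * (int t - 1) * fact (t - 1) \<and>
    - 4 * (int t - 1) * fact (t - 1) < 0"
proof -
  have coeff: "basis_coeff schur ([3, 3, 3] @ replicate (t - 3) 1) (chromatic_sym (F_graph t))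
      = - 4 * (int t - 1) * fact (t - 1)"
    using basis_coeff_schur_F_graph[OF assms] by simp
  have neg: "- 4 * (int t - 1) * fact (t - 1) < 0"
    using assms by (simp add: mult_neg_pos)
  have "is_partition ([3, 3, 3] @ replicate (t - 3) 1)"
    by (auto simp: is_partition_def sorted_wrt_ge_replicate)
  then have "\<not> schur_positive (F_graph t)"
    using coeff neg unfolding schur_positive_def by (metis not_le)
  then show ?thesis
    using connected_F_graph strongly_nice_F_graph[OF assms] coeff neg assms by simp
qed

end
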